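(* Let $m$ and $N$ be positive integers and $l$ an integer with $1\le l\le N$. The number of rhombus tilings of the hexagon $H(N+1,2m-1)$ with side lengths $N+1,2m-1,N+1,N+1,2m-1,N+1$ (all angles $120^\circ$) which contain the $l$-th rhombus on the symmetry axis which cuts through the two sides of length $2m-1$ equals $$ \frac{m\binom{m+N}{m}\binom{m+N-1}{m}}{\binom{2m+2N-1}{2m}} \left(\sum_{e=0}^{l-1}(-1)^{e}\binom{N}{e}\frac{(N-2e)\left(\frac12\right)_e}{(m+e)(m+N-e)\left(\frac12-N\right)_e}\right) \prod_{i=1}^{N+1}\prod_{j=1}^{N+1}\prod_{k=1}^{2m-1}\frac{i+j+k-1}{i+j+k-2}. $$
   Context: Shifted factorial: $(a)_k:=a(a+1)\cdots(a+k-1)$ for $k\ge 1$, and $(a)_0:=1$. For integers $n\ge1$, $M\ge1$ let $H(n,M)$ be the hexagon in the plane with all angles $120^\circ$ and sides, in cyclic order, $n,M,n,n,M,n$, placed so that its vertices are $(0,\pm\frac M2)$, $(\frac{\sqrt3}{2}n,\pm\frac{M+n}{2})$, $(\sqrt3n,\pm\frac M2)$. The sides of length $M$ are the two vertical ones, and the symmetry axis cutting through them is the line $y=0$. $H(n,M)$ is subdivided into unit equilateral triangles by the triangular lattice generated by $(0,1)$ and $(\frac{\sqrt3}{2},\frac12)$, translated so that the vertices of $H(n,M)$ are lattice points. A rhombus means the union of two of these unit triangles sharing an edge (side lengths $1$, angles $60^\circ$ and $120^\circ$). A rhombus tiling of $H(n,M)$ is a set of rhombi with pairwise disjoint interiors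 whose union is $H(n,M)$; it contains a given rhombus if that rhombus is one of its tiles. For $n=N+1$ and $M=2m-1$ odd, there are $N$ rhombi in the hexagon whose long diagonal lies on the axis $y=0$, numbered from left to right: the $l$-th one ($1\le l\le N$) has vertices $((l-\frac12)\sqrt3,0)$, $((l+\frac12)\sqrt3,0)$, $(l\sqrt3,\pm\frac12)$. *)

theory Defs
  imports "HOL-Analysis.Analysis"
begin

definition hexagon :: "nat \<Rightarrow> nat \<Rightarrow> (real \<times> real) set" where
  "hexagon n M = convex hull
     {(0, real M / 2), (0, - real M / 2),
      (sqrt 3 / 2 * real n, (real M + real n) / 2), (sqrt 3 / 2 * real n, - (real M + real n) / 2),
      (sqrt 3 * real n, real M / 2), (sqrt 3 * real n, - real M / 2)}"

text \<open>The triangular lattice is translated by \<open>(0, M/2)\<close>, which makes all six vertices of the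
  hexagon lattice points.\<close>

definition lattice_points :: "nat \<Rightarrow> (real \<times> real) set" where
  "lattice_points M =
     {(0, real M / 2) + of_int i *\<^sub>R (0, 1) + of_int j *\<^sub>R (sqrt 3 / 2, 1 / 2) | i j :: int. True}"

definition unit_triangle :: "nat \<Rightarrow> nat \<Rightarrow> real \<times> real \<Rightarrow> real \<times> real \<Rightarrow> real \<times> real \<Rightarrow> bool" where
  "unit_triangle n M p q r \<longleftrightarrow>
     {p, q, r} \<subseteq> lattice_points M \<and> dist p q = 1 \<and> dist q r = 1 \<and> dist r p = 1 \<and>
     convex hull {p, q, r} \<subseteq> hexagon n M"

text \<open>Two distinct unit triangles sharing the edge from \<open>q\<close> to \<open>r\<close>.\<close>

definition rhombi :: "nat \<Rightarrow> nat \<Rightarrow> (real \<times> real) set set" where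
  "rhombi n M = {convex hull {p, q, r} \<union> convex hull {s, q, r} | p q r s.
     unit_triangle n M p q r \<and> unit_triangle n M s q r \<and> p \<noteq> s}"

definition rhombus_tiling :: "nat \<Rightarrow> nat \<Rightarrow> (real \<times> real) set set \<Rightarrow> bool" where
  "rhombus_tiling n M T \<longleftrightarrow>
     T \<subseteq> rhombi n M \<and> pairwise (\<lambda>A B. interior A \<inter> interior B = {}) T \<and> \<Union>T = hexagon n M"

definition axis_rhombus :: "nat \<Rightarrow> (real \<times> real) set" where
  "axis_rhombus l = convex hull
     {((real l - 1 / 2) * sqrt 3, 0), ((real l + 1 / 2) * sqrt 3, 0),
      (real l * sqrt 3, 1 / 2), (real l * sqrt 3, - 1 / 2)}"

end

theory Submission
  imports Defs "Jordan_Normal_Form.Determinant"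
begin

text \<open>Cutting along the vertical lattice lines, a rhombus tiling of the hexagon is a family of \<open>M\<close>
  non-intersecting lattice paths, and it contains the axis rhombus \<open>l\<close> iff the paths avoid one
  central vertex \<open>c\<close>. Such families are counted by \<open>det (A - a b\<^sup>T)\<close> with binomial \<open>A\<close>, \<open>a\<close> (paths
  to \<open>c\<close>) and \<open>b\<close> (paths from \<open>c\<close>), which is \<open>det A * (1 - b\<^sup>T A\<^sup>-\<^sup>1 a)\<close>, where \<open>det A\<close> is
  MacMahon's product. By reflection symmetry \<open>A v = a\<close> is solved by the coefficients of \<open>p(D)\<close>,
  \<open>D = z + 2 + 1/z\<close>, for a polynomial \<open>p\<close> determined by a Hankel system in the constant terms
  \<open>binomial (2 r) r\<close> of \<open>D ^ r\<close>. The orthogonal polynomials of that moment sequence are Jacobi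
  polynomials with explicit moments (Pfaff-Saalschuetz), so \<open>1 - b\<^sup>T A\<^sup>-\<^sup>1 a\<close> becomes a sum over the
  degree \<open>k < m\<close>; its increments in \<open>l\<close> telescope in \<open>k\<close> and give the stated sum over \<open>e\<close>.\<close>

section \<open>Orthogonal polynomials for the moments \<open>binomial (2 r) r\<close>\<close>

text \<open>The index range is what makes polynomials in \<open>D\<close> fit. Row \<open>i\<close>
  of \<open>A\<close> lists coefficients of \<open>D ^ n\<close>, and \<open>p(D)\<close> with
  degree below \<open>m\<close> has exponents from \<open>-(m - 1)\<close> to \<open>m - 1\<close>,
  exactly \<open>2 * m - 1\<close> of them, so \<open>A v\<close> is a stretch of the coefficients
  of \<open>D ^ n * p(D)\<close> with nothing truncated. It has to agree with \<open>D ^ l\<close>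
  at all exponents of absolute value below \<open>m\<close>. Both sides are invariant under
  exchanging \<open>z\<close> and \<open>1/z\<close>, which leaves \<open>m\<close> conditions on
  constant terms, a Hankel system with moments \<open>cbinom (n + i + j)\<close>. These belong to
  the arcsine law on \<open>[0, 4]\<close> multiplied by \<open>x ^ n\<close>. The number subtracted
  from 1 is the constant term of \<open>D ^ (n - l) * p(D)\<close>. In terms of the weight it is the
  expansion of the inner product of \<open>x ^ (l - n)\<close> and \<open>x ^ (- l)\<close> in
  orthogonal polynomials, cut off at degree \<open>m\<close>. The formal value of that inner product
  is 1, so the quantity of interest is a tail. It is 0 at \<open>l = 0\<close>, which is where the
  summation over \<open>e\<close> starts.\<close>

lemma pfaff_saalschuetz:
  fixes a c d :: real
  assumes "c > 0" "d > 0"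
  shows "(\<Sum>i\<le>k. (- 1) ^ i * real (k choose i) * pochhammer a i * pochhammer (real k + c + d - a - 1) i
            / (pochhammer c i * pochhammer d i))
       = pochhammer (c - a) k * pochhammer (d - a) k / (pochhammer c k * pochhammer d k)"
  using assms
proof (induction k arbitrary: a c d)
  case 0
  then show ?case by simp
next
  case (Suc k)
  \<comment> \<open>The balancing parameter. At level \<open>Suc k\<close> it becomes
    \<open>x + 1\<close>, and the sum at level \<open>k\<close> with \<open>a\<close>,
    \<open>c\<close>, \<open>d\<close> all raised by one also has \<open>x + 1\<close>. So the
    difference of the sums for \<open>Suc k\<close> and \<open>k\<close> is again covered by the
    induction hypothesis, and \<open>c - a\<close>, \<open>d - a\<close> do not change.\<close>
  define x where "x = real k + c + d - a - 1"
  define f where "f i = (- 1) ^ i * pochhammer a i / (pochhammer c i * pochhammer d i)" for i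
  have pos: "c \<noteq> 0" "d \<noteq> 0" "pochhammer c i \<noteq> 0" "pochhammer d i \<noteq> 0"
      "pochhammer (c + 1) i \<noteq> 0" "pochhammer (d + 1) i \<noteq> 0" "c + real i \<noteq> 0" "d + real i \<noteq> 0" for i
    using Suc.prems pochhammer_pos[of c i] pochhammer_pos[of d i]
      pochhammer_pos[of "c + 1" i] pochhammer_pos[of "d + 1" i] by auto
  have diff: "real (Suc k choose Suc i) * pochhammer (x + 1) (Suc i) - real (k choose Suc i) * pochhammer x (Suc i)
      = (x + real k + 1) * real (k choose i) * pochhammer (x + 1) i" for i
  proof -
    have "real (Suc i) * real (k choose Suc i) = real (k - i) * real (k choose i)"
      using binomial_absorb_comp[of k i] binomial_absorption[of i k] 
      by (metis binomial_absorb_comp binomial_absorption mult.commute of_nat_mult)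
    then have *: "real (Suc i) * real (k choose Suc i) = (real k - real i) * real (k choose i)"
      by (cases "i \<le> k") (auto simp: of_nat_diff binomial_eq_0)
    have "real (Suc k choose Suc i) * pochhammer (x + 1) (Suc i) - real (k choose Suc i) * pochhammer x (Suc i)
       = pochhammer (x + 1) i * (real (k choose i) * (x + 1 + real i) + real (Suc i) * real (k choose Suc i))"
      unfolding pochhammer_rec[of x] pochhammer_Suc[of "x + 1"] by (simp add: algebra_simps)
    also have "\<dots> = (x + real k + 1) * real (k choose i) * pochhammer (x + 1) i"
      unfolding * by (simp add: algebra_simps)
    finally show ?thesis .
  qed
  have IH: "(\<Sum>i\<le>k. (- 1) ^ i * real (k choose i) * pochhammer (a + 1) i * pochhammer (x + 1) i
            / (pochhammer (c + 1) i * pochhammer (d + 1) i))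
       = pochhammer (c - a) k * pochhammer (d - a) k / (pochhammer (c + 1) k * pochhammer (d + 1) k)"
    using Suc.IH[of "c + 1" "d + 1" "a + 1"] Suc.prems by (simp add: x_def algebra_simps)
  have "(\<Sum>i\<le>Suc k. f i * (real (Suc k choose i) * pochhammer (x + 1) i)) -
        (\<Sum>i\<le>Suc k. f i * (real (k choose i) * pochhammer x i))
      = (\<Sum>i\<le>Suc k. f i * (real (Suc k choose i) * pochhammer (x + 1) i - real (k choose i) * pochhammer x i))"
    by (simp only: sum_subtractf right_diff_distrib)
  also have "\<dots> = (\<Sum>i\<le>k. f (Suc i) * ((x + real k + 1) * real (k choose i) * pochhammer (x + 1) i))"
    by (subst sum.atMost_Suc_shift) (simp only: diff binomial_n_0 pochhammer_0 diff_self mult_zero_right add_0_left)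
  also have "\<dots> = (\<Sum>i\<le>k. - ((x + real k + 1) * a / (c * d)) * ((- 1) ^ i * real (k choose i) * pochhammer (a + 1) i * pochhammer (x + 1) i
            / (pochhammer (c + 1) i * pochhammer (d + 1) i)))"
    unfolding f_def by (intro sum.cong refl) (simp add: pochhammer_rec pos field_simps)
  also have "\<dots> = - ((x + real k + 1) * a / (c * d)) * (pochhammer (c - a) k * pochhammer (d - a) k / (pochhammer (c + 1) k * pochhammer (d + 1) k))"
    unfolding sum_distrib_left[symmetric] IH ..
  finally have A: "(\<Sum>i\<le>Suc k. f i * (real (Suc k choose i) * pochhammer (x + 1) i)) =
        (\<Sum>i\<le>Suc k. f i * (real (k choose i) * pochhammer x i)) - ((x + real k + 1) * a / (c * d)) * (pochhammer (c - a) k * pochhammer (d - a) k / (pochhammer (c + 1) k * pochhammer (d + 1) k))"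
    by simp
  have B: "(\<Sum>i\<le>Suc k. f i * (real (k choose i) * pochhammer x i)) = pochhammer (c - a) k * pochhammer (d - a) k / (pochhammer c k * pochhammer d k)"
    using Suc.IH[of c d a] Suc.prems by (simp add: f_def x_def algebra_simps)
  have sh: "c * pochhammer (c + 1) k = pochhammer c k * (c + real k)" "d * pochhammer (d + 1) k = pochhammer d k * (d + real k)"
    by (metis pochhammer_Suc pochhammer_rec)+
  have C: "((x + real k + 1) * a / (c * d)) * (pochhammer (c - a) k * pochhammer (d - a) k / (pochhammer (c + 1) k * pochhammer (d + 1) k))
     = (x + real k + 1) * a * (pochhammer (c - a) k * pochhammer (d - a) k) / ((pochhammer c k * (c + real k)) * (pochhammer d k * (d + real k)))"
    unfolding sh[symmetric] by (simp add: field_simps)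
  have D: "u / (p * q) - w * u / ((p * r) * (q * s)) = (r * s - w) * u / ((p * r) * (q * s))"
    if "p \<noteq> 0" "q \<noteq> 0" "r \<noteq> 0" "s \<noteq> 0" for u p q w r s :: real
    using that by (simp add: field_simps)
  have "(\<Sum>i\<le>Suc k. f i * (real (Suc k choose i) * pochhammer (x + 1) i)) =
     ((c + real k) * (d + real k) - (x + real k + 1) * a) * (pochhammer (c - a) k * pochhammer (d - a) k) / ((pochhammer c k * (c + real k)) * (pochhammer d k * (d + real k)))"
    unfolding A B C by (rule D) (use pos in auto)
  \<comment> \<open>The balancing value of \<open>x\<close> is what makes this numerator
    factor.\<close>
  also have "(c + real k) * (d + real k) - (x + real k + 1) * a = (c - a + real k) * (d - a + real k)"
    by (simp add: x_def algebra_simps)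
  finally show ?case
    by (simp add: f_def x_def pochhammer_Suc mult_ac add_ac)
qed

section \<open>Central binomial coefficients and the moments of Jacobi polynomials\<close>

definition cbinom :: "nat \<Rightarrow> real" where
  "cbinom r = real ((2 * r) choose r)"

lemma cbinom_0 [simp]: "cbinom 0 = 1"
  by (simp add: cbinom_def)

lemma cbinom_pos: "cbinom r > 0"
  by (simp add: cbinom_def)

lemma cbinom_nonzero [simp]: "cbinom r \<noteq> 0"
  using cbinom_pos[of r] by simp

lemma cbinom_Suc: "(real r + 1) * cbinom (Suc r) = 2 * (2 * real r + 1) * cbinom r"
proof -
  have "Suc r * (Suc (2 * r + 1) choose Suc r) = Suc (2 * r + 1) * ((2 * r + 1) choose r)"
    using Suc_times_binomial_eq[of "2 * r + 1" r] by (simp only: mult.commute)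
  moreover have "Suc r * ((2 * r + 1) choose r) = (2 * r + 1) * ((2 * r) choose r)"
    using binomial_absorb_comp[of "2 * r + 1" r] by simp
  ultimately have "Suc r * (Suc r * (Suc (2 * r + 1) choose Suc r)) = Suc r * (2 * ((2 * r + 1) * ((2 * r) choose r)))"
    by (metis (no_types, opaque_lifting) Suc_eq_plus1 add_Suc_right mult.assoc mult.commute mult_2 mult_Suc_right add_Suc)
  then have "Suc r * (Suc (2 * r + 1) choose Suc r) = 2 * ((2 * r + 1) * ((2 * r) choose r))"
    by (simp only: mult_cancel1) simp
  then have "real (Suc r * (Suc (2 * r + 1) choose Suc r)) = real (2 * ((2 * r + 1) * ((2 * r) choose r)))"
    by (simp only:)
  then show ?thesis by (simp add: cbinom_def algebra_simps)
qed

text \<open>Writing shifted moments by rising factorials turns a moment of a polynomial into a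
  hypergeometric sum.\<close>

lemma cbinom_add: "cbinom (r + i) * pochhammer (real r + 1) i = cbinom r * 4 ^ i * pochhammer (real r + 1 / 2) i"
proof (induction i)
  case (Suc i)
  have "cbinom (r + Suc i) * pochhammer (real r + 1) (Suc i)
      = pochhammer (real r + 1) i * ((real (r + i) + 1) * cbinom (Suc (r + i)))"
    by (simp add: pochhammer_Suc mult_ac add_ac)
  also have "\<dots> = 2 * (2 * real (r + i) + 1) * (cbinom (r + i) * pochhammer (real r + 1) i)"
    unfolding cbinom_Suc by simp
  also have "\<dots> = cbinom r * 4 ^ Suc i * pochhammer (real r + 1 / 2) (Suc i)"
    unfolding Suc.IH by (simp add: pochhammer_Suc algebra_simps)
  finally show ?case .
qed simp

lemma cbinom_eq_pochhammer: "cbinom k = 4 ^ k * pochhammer (1 / 2) k / fact k"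
  using cbinom_add[of 0 k] by (simp add: field_simps flip: pochhammer_fact)

text \<open>\<open>\<Sum>i. jac n k i * x ^ i\<close> is, up to a factor, the Jacobi polynomial of degree \<open>k\<close> on \<open>[0, 4]\<close> for
  the weight \<open>x\<close> to the power \<open>n - 1 / 2\<close> times \<open>(4 - x)\<close> to the power \<open>- 1 / 2\<close>; for \<open>n = 0\<close> the
  moments of this weight are proportional to \<open>cbinom\<close>.\<close>

definition jac :: "nat \<Rightarrow> nat \<Rightarrow> nat \<Rightarrow> real" where
  "jac n k i = (- 1) ^ i * real (k choose i) * pochhammer (real k + real n) i / (pochhammer (real n + 1 / 2) i * 4 ^ i)"

text \<open>The closed form of the integral of the Jacobi polynomial times \<open>x ^ r\<close>
  against the arcsine law on \<open>[0, 4]\<close>. The factor \<open>pochhammer (n - r) k\<close>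
  carries the orthogonality: it vanishes for \<open>r\<close> from \<open>n\<close> to
  \<open>n + k - 1\<close>.\<close>

definition jac_moment :: "nat \<Rightarrow> nat \<Rightarrow> nat \<Rightarrow> real" where
  "jac_moment n k r = cbinom r * pochhammer (real n - real r) k * pochhammer (1 / 2) k
     / (pochhammer (real n + 1 / 2) k * pochhammer (real r + 1) k)"

lemma jac_eq_0: "k < i \<Longrightarrow> jac n k i = 0"
  by (simp add: jac_def binomial_eq_0)

lemma pochhammer_nonzero: "x > 0 \<Longrightarrow> pochhammer (x::real) k \<noteq> 0"
  using pochhammer_pos[of x k] by simp

text \<open>Pfaff-Saalschuetz with \<open>c = n + 1/2\<close>, \<open>d = r + 1\<close> and
  \<open>a = r + 1/2\<close>. The balancing parameter is then \<open>k + n\<close>, which is the one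
  in \<open>jac\<close>, and \<open>c - a = n - r\<close>, \<open>d - a = 1/2\<close> give the two
  numerators of \<open>jac_moment\<close>.\<close>

lemma sum_jac_cbinom:
  assumes "k < m"
  shows "(\<Sum>i<m. jac n k i * cbinom (r + i)) = jac_moment n k r"
proof -
  have "(\<Sum>i<m. jac n k i * cbinom (r + i)) = (\<Sum>i\<le>k. jac n k i * cbinom (r + i))"
    using assms by (intro sum.mono_neutral_right) (auto simp: jac_eq_0)
  also have "\<dots> = (\<Sum>i\<le>k. cbinom r * ((- 1) ^ i * real (k choose i) * pochhammer (real r + 1 / 2) i * pochhammer (real k + (real n + 1 / 2) + (real r + 1) - (real r + 1 / 2) - 1) i
            / (pochhammer (real n + 1 / 2) i * pochhammer (real r + 1) i)))"
  proof (intro sum.cong refl)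
    fix i
    have "cbinom (r + i) = cbinom r * 4 ^ i * pochhammer (real r + 1 / 2) i / pochhammer (real r + 1) i"
      using cbinom_add[of r i] pochhammer_nonzero[of "real r + 1" i] by (simp add: field_simps)
    then show "jac n k i * cbinom (r + i) = cbinom r * ((- 1) ^ i * real (k choose i) * pochhammer (real r + 1 / 2) i * pochhammer (real k + (real n + 1 / 2) + (real r + 1) - (real r + 1 / 2) - 1) i
            / (pochhammer (real n + 1 / 2) i * pochhammer (real r + 1) i))"
      by (simp add: jac_def)
  qed
  also have "\<dots> = jac_moment n k r"
    unfolding sum_distrib_left[symmetric] by (subst pfaff_saalschuetz) (simp_all add: jac_moment_def)
  finally show ?thesis .
qed

lemma sum_jac_cbinom_atMost: "(\<Sum>i\<le>k. jac n k i * cbinom (r + i)) = jac_moment n k r"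
  using sum_jac_cbinom[of k "Suc k" n r] by (simp add: lessThan_Suc_atMost)

lemma jac_moment_eq_0: "j < k \<Longrightarrow> jac_moment n k (n + j) = 0"
  by (simp add: jac_moment_def pochhammer_of_nat_eq_0_lemma)

text \<open>The squared norm for the weight with the extra factor \<open>x ^ n\<close>: all terms of
  the polynomial below the leading one are orthogonal to it.\<close>

definition jac_norm :: "nat \<Rightarrow> nat \<Rightarrow> real" where
  "jac_norm n k = jac n k k * jac_moment n k (n + k)"

lemma jac_norm_eq:
  assumes "n \<ge> 1"
  shows "jac_norm n k * (cbinom k * (real n + 2 * real k)) * pochhammer (real n + 1 / 2) k ^ 2
     = (real n + real k) * cbinom (n + k) * pochhammer (1 / 2) k ^ 2"
proof -
  have p: "pochhammer (- real k) k = (- 1) ^ k * fact k"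
    by (rule pochhammer_same)
  \<comment> \<open>The factor \<open>n + 2 * k\<close> arises from moving the rising factorial in
    the leading coefficient to the starting point \<open>n + k + 1\<close>, where it cancels against
    the moment.\<close>
  have q: "pochhammer (real n + real k) k * (real n + 2 * real k) = (real n + real k) * pochhammer (real n + real k + 1) k"
    using pochhammer_Suc[of "real n + real k" k] pochhammer_rec[of "real n + real k" k] by simp
  have nz: "pochhammer (real n + real k + 1) k \<noteq> 0" "pochhammer (real n + 1 / 2) k \<noteq> 0"
    by (intro pochhammer_nonzero; simp)+
  have "jac_norm n k * (cbinom k * (real n + 2 * real k)) * pochhammer (real n + 1 / 2) k ^ 2
      = pochhammer (1 / 2) k ^ 2 * cbinom (n + k) * (pochhammer (real n + real k) k * (real n + 2 * real k)) / pochhammer (real n + real k + 1) k"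
    using nz by (simp add: jac_norm_def jac_def jac_moment_def p cbinom_eq_pochhammer[of k] power2_eq_square field_simps
         flip: power_mult_distrib)
  also have "\<dots> = (real n + real k) * cbinom (n + k) * pochhammer (1 / 2) k ^ 2"
    unfolding q using nz by (simp add: field_simps)
  finally show ?thesis .
qed

lemma jac_norm_nonzero: "n \<ge> 1 \<Longrightarrow> jac_norm n k \<noteq> 0"
  using jac_norm_eq[of n k] pochhammer_nonzero[of "1/2" k] by auto

text \<open>The double sum over both polynomials is symmetric, so the one of larger degree can
  always be the one whose moments are taken. For \<open>k < k'\<close> this requires the swap of
  summations; otherwise only the leading term can survive.\<close>

lemma jac_orthogonal:
  assumes "k < m" "k' < m"
  shows "(\<Sum>j\<le>k'. jac n k' j * jac_moment n k (n + j)) = (if k = k' then jac_norm n k else 0)"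
proof (cases "k < k'")
  case True
  have "(\<Sum>j\<le>k'. jac n k' j * jac_moment n k (n + j)) = (\<Sum>j\<le>k'. \<Sum>i\<le>k. jac n k' j * (jac n k i * cbinom (n + j + i)))"
    by (simp add: sum_distrib_left flip: sum_jac_cbinom_atMost)
  also have "\<dots> = (\<Sum>i\<le>k. jac n k i * (\<Sum>j\<le>k'. jac n k' j * cbinom ((n + i) + j)))"
    by (subst sum.swap) (simp add: sum_distrib_left mult_ac add_ac)
  also have "\<dots> = 0"
    using True by (simp add: sum_jac_cbinom_atMost jac_moment_eq_0)
  finally show ?thesis using True by simp
next
  case False
  have "(\<Sum>j\<le>k'. jac n k' j * jac_moment n k (n + j)) = (\<Sum>j\<in>{..k'} \<inter> {k}. jac n k' j * jac_moment n k (n + j))"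
    using False by (intro sum.mono_neutral_right) (auto intro!: jac_moment_eq_0)
  then show ?thesis using False by (auto simp: jac_norm_def)
qed

text \<open>For \<open>l \<le> n\<close>, the degree \<open>k\<close> term in the expansion of the
  inner product of \<open>x ^ (l - n)\<close> and \<open>x ^ (- l)\<close>: the factor
  \<open>x ^ n\<close> of the weight turns the two coefficients into moments of order
  \<open>l\<close> and \<open>n - l\<close>.\<close>

definition kernel_term :: "nat \<Rightarrow> nat \<Rightarrow> nat \<Rightarrow> real" where
  "kernel_term n l k = jac_moment n k l * jac_moment n k (n - l) / jac_norm n k"

text \<open>The solution is the orthogonal expansion with coefficients \<open>b k\<close>. Its
  residual \<open>d\<close> is annihilated by every polynomial \<open>jac n k'\<close> with
  \<open>k' < m\<close>. These form a triangular family with nonzero leading coefficients, so the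
  residual vanishes entry by entry.\<close>

lemma hankel_solution:
  assumes "n \<ge> 1"
  obtains p where "\<And>j. j < m \<Longrightarrow> (\<Sum>i<m. p i * cbinom (n + i + j)) = cbinom (l + j)"
    and "(\<Sum>i<m. p i * cbinom (n - l + i)) = (\<Sum>k<m. kernel_term n l k)"
proof
  define b where "b k = jac_moment n k l / jac_norm n k" for k
  define p where "p i = (\<Sum>k<m. b k * jac n k i)" for i
  have p: "(\<Sum>i<m. p i * cbinom (r + i)) = (\<Sum>k<m. b k * jac_moment n k r)" for r
  proof -
    have "(\<Sum>i<m. p i * cbinom (r + i)) = (\<Sum>k<m. b k * (\<Sum>i<m. jac n k i * cbinom (r + i)))"
      unfolding p_def sum_distrib_left sum_distrib_right by (subst sum.swap) (simp add: mult_ac)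
    then show ?thesis by (simp add: sum_jac_cbinom)
  qed
  define d where "d j = (\<Sum>k<m. b k * jac_moment n k (n + j)) - cbinom (l + j)" for j
  have sum_d: "(\<Sum>j\<le>k'. jac n k' j * d j) = 0" if "k' < m" for k'
  proof -
    have "(\<Sum>j\<le>k'. jac n k' j * d j) =
       (\<Sum>k<m. b k * (\<Sum>j\<le>k'. jac n k' j * jac_moment n k (n + j))) - (\<Sum>j\<le>k'. jac n k' j * cbinom (l + j))"
      unfolding d_def right_diff_distrib sum_subtractf sum_distrib_left by (subst sum.swap) (simp add: mult_ac)
    also have "(\<Sum>k<m. b k * (\<Sum>j\<le>k'. jac n k' j * jac_moment n k (n + j))) = (\<Sum>k<m. if k = k' then b k * jac_norm n k else 0)"
      using that by (intro sum.cong refl) (simp add: jac_orthogonal)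
    also have "\<dots> = jac_moment n k' l"
      using that jac_norm_nonzero[OF assms] by (simp add: b_def)
    finally show ?thesis by (simp add: sum_jac_cbinom_atMost)
  qed
  have "d j = 0" if "j < m" for j
    using that
  proof (induction j rule: less_induct)
    case (less j)
    have "(\<Sum>i\<le>j. jac n j i * d i) = (\<Sum>i\<in>{j}. jac n j i * d i)"
      using less by (intro sum.mono_neutral_right) auto
    then have "jac n j j * d j = 0" using sum_d[OF less.prems] by simp
    moreover have "jac n j j \<noteq> 0" using jac_norm_nonzero[OF assms, of j] by (auto simp: jac_norm_def)
    ultimately show ?case by simp
  qed
  then show "(\<Sum>i<m. p i * cbinom (n + i + j)) = cbinom (l + j)" if "j < m" for j
    using p[of "n + j"] that by (simp add: d_def add_ac)
  show "(\<Sum>i<m. p i * cbinom (n - l + i)) = (\<Sum>k<m. kernel_term n l k)"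
    by (simp add: p b_def kernel_term_def)
qed

section \<open>Closed form of the kernel terms and their telescoping\<close>

lemma kernel_term_0: "kernel_term n l 0 = cbinom l * cbinom (n - l) / cbinom n"
  by (simp add: kernel_term_def jac_norm_def jac_moment_def jac_def)

text \<open>The orders \<open>l\<close> and \<open>n - l\<close> of the two moments are exchanged by
  subtraction from \<open>n\<close>. Hence rising factorials starting at \<open>l\<close> and
  \<open>l + 1\<close>, and at \<open>n - l\<close> and \<open>n - l + 1\<close>, meet in one
  fraction and collapse to \<open>l / (l + k)\<close> and \<open>(n - l) / (n - l + k)\<close>. With
  \<open>k \<ge> 1\<close> these denominators stay positive at the ends \<open>l = 0\<close> and
  \<open>l = n\<close>.\<close>

lemma kernel_term_eq:
  assumes "k \<ge> 1" "l \<le> n" "n \<ge> 1"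
  shows "kernel_term n l k = cbinom k * (real n + 2 * real k) / ((real n + real k) * cbinom (n + k))
     * (real l * cbinom l) * (real (n - l) * cbinom (n - l)) / ((real l + real k) * (real (n - l) + real k))"
proof -
  have shift: "pochhammer x k = x / (x + real k) * pochhammer (x + 1) k" if "x \<ge> 0" for x :: real
    using pochhammer_Suc[of x k] pochhammer_rec[of x k] that assms by (simp add: field_simps)
  have nz: "pochhammer (real l + 1) k \<noteq> 0" "pochhammer (real (n - l) + 1) k \<noteq> 0" "pochhammer (real n + 1 / 2) k \<noteq> 0"
     "pochhammer (1 / 2 :: real) k \<noteq> 0" "real n + real k \<noteq> 0" "real l + real k \<noteq> 0" "real (n - l) + real k \<noteq> 0" "real n + 2 * real k \<noteq> 0"
    using assms by (auto intro!: pochhammer_nonzero)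
  have sub: "real n - real l = real (n - l)" "real n - real (n - l) = real l"
    using assms by (auto simp: of_nat_diff)
  have norm: "jac_norm n k = (real n + real k) * cbinom (n + k) * pochhammer (1 / 2) k ^ 2 / (cbinom k * (real n + 2 * real k) * pochhammer (real n + 1 / 2) k ^ 2)"
    using jac_norm_eq[OF assms(3), of k] nz by (subst nonzero_eq_divide_eq) (simp_all add: mult_ac)
  show ?thesis
    unfolding kernel_term_def jac_moment_def sub norm
    using nz by (simp add: shift[of "real l"] shift[of "real (n - l)"] power2_eq_square)
      (simp add: mult_ac)
qed

text \<open>The companion of \<open>kernel_term\<close> in a pair of Wilf-Zeilberger type, see \<open>kernel_term_diff\<close>.\<close>

definition hole_term :: "nat \<Rightarrow> nat \<Rightarrow> nat \<Rightarrow> real" where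
  "hole_term N m e = real m * cbinom m / cbinom (m + N) * (cbinom e * cbinom (N - e) * (real N - 2 * real e))
     / ((real m + real e) * (real m + real N - real e))"

text \<open>The rational part of \<open>kernel_term_diff\<close>, with \<open>x = e\<close> and
  \<open>y = N - e\<close>, once the central binomials common to all four terms are removed.\<close>

lemma hole_term_identity:
  fixes x y k :: real
  assumes "x + k > 0" "y + k > 0" "x + k + 1 > 0" "y + k + 1 > 0"
  shows "(x + y + 1 + 2 * k) * (x * (2 * y + 1) / ((x + k) * (y + 1 + k)) - y * (2 * x + 1) / ((x + 1 + k) * (y + k)))
    = (y - x) * ((2 * k + 1) * (x + y + 1 + k) / ((k + 1 + x) * (k + 1 + y)) - k * (2 * k + 2 * (x + y) + 1) / ((k + x) * (k + y)))"
proof -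
  have combine1: "p / (a * d) - q / (c * b) = (p * b * c - q * a * d) / (a * b * c * d)"
    if "a \<noteq> 0" "b \<noteq> 0" "c \<noteq> 0" "d \<noteq> 0" for p q a b c d :: real
    using that by (simp add: field_simps)
  have combine2: "p / (c * d) - q / (a * b) = (p * a * b - q * c * d) / (a * b * c * d)"
    if "a \<noteq> 0" "b \<noteq> 0" "c \<noteq> 0" "d \<noteq> 0" for p q a b c d :: real
    using that by (simp add: field_simps)
  have shape: "k + 1 + x = x + 1 + k" "k + 1 + y = y + 1 + k" "k + x = x + k" "k + y = y + k" by simp_all
  have nz: "x + k \<noteq> 0" "y + k \<noteq> 0" "x + 1 + k \<noteq> 0" "y + 1 + k \<noteq> 0"
    using assms by auto
  have poly: "(x + y + 1 + 2 * k) * (x * (2 * y + 1) * (y + k) * (x + 1 + k) - y * (2 * x + 1) * (x + k) * (y + 1 + k))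
    = (y - x) * ((2 * k + 1) * (x + y + 1 + k) * (x + k) * (y + k) - k * (2 * k + 2 * (x + y) + 1) * (x + 1 + k) * (y + 1 + k))"
    by (simp add: algebra_simps)
  show ?thesis
    unfolding shape combine1[OF nz] combine2[OF nz] using poly by (metis times_divide_eq_right)
qed

lemma kernel_term_diff:
  assumes "k \<ge> 1" "e \<le> N"
  shows "kernel_term (N + 1) e k - kernel_term (N + 1) (e + 1) k = hole_term N (k + 1) e - hole_term N k e"
proof -
  define x where "x = real e"
  define y where "y = real (N - e)"
  define K where "K = real k"
  define U where "U = cbinom e * cbinom (N - e)"
  \<comment> \<open>Together with \<open>U\<close>, up to a factor 2, the common factor of all four
    terms. By \<open>cn\<close> its denominator can also be written with
    \<open>cbinom (k + N)\<close>, the form in which \<open>hole_term N k e\<close> has it.\<close>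
  define Q where "Q = cbinom k / ((x + y + 1 + K) * cbinom (N + 1 + k))"
  have Nxy: "real N = x + y" using assms by (simp add: x_def y_def of_nat_diff)
  have pos: "x + K > 0" "y + K > 0" "x + K + 1 > 0" "y + K + 1 > 0" "K > 0" "x \<ge> 0" "y \<ge> 0"
    using assms by (auto simp: x_def y_def K_def)
  have ce: "(x + 1) * cbinom (e + 1) = 2 * (2 * x + 1) * cbinom e"
    using cbinom_Suc[of e] by (simp add: x_def)
  have cy: "(y + 1) * cbinom (Suc (N - e)) = 2 * (2 * y + 1) * cbinom (N - e)"
    using cbinom_Suc[of "N - e"] by (simp add: y_def)
  have ck: "(K + 1) * cbinom (k + 1) = 2 * (2 * K + 1) * cbinom k"
    using cbinom_Suc[of k] by (simp add: K_def)
  have cn: "(x + y + 1 + K) * cbinom (N + 1 + k) = 2 * (2 * K + 2 * (x + y) + 1) * cbinom (k + N)"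
    using cbinom_Suc[of "k + N"] by (simp add: K_def Nxy algebra_simps)
  have L1: "kernel_term (N + 1) e k = 2 * U * Q * (x + y + 1 + 2 * K) * (x * (2 * y + 1) / ((x + K) * (y + 1 + K)))"
  proof -
    have "N + 1 - e = Suc (N - e)" using assms by auto
    then have "kernel_term (N + 1) e k = Q * (x + y + 1 + 2 * K) * (x * cbinom e) * ((y + 1) * cbinom (Suc (N - e))) / ((x + K) * (y + 1 + K))"
      using assms by (subst kernel_term_eq) (simp_all add: Q_def x_def y_def K_def of_nat_diff add_ac)
    then show ?thesis unfolding cy by (simp add: U_def)
  qed
  have L2: "kernel_term (N + 1) (e + 1) k = 2 * U * Q * (x + y + 1 + 2 * K) * (y * (2 * x + 1) / ((x + 1 + K) * (y + K)))"
  proof -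
    have "kernel_term (N + 1) (e + 1) k = Q * (x + y + 1 + 2 * K) * ((x + 1) * cbinom (e + 1)) * (y * cbinom (N - e)) / ((x + 1 + K) * (y + K))"
      using assms by (subst kernel_term_eq) (simp_all add: Q_def x_def y_def K_def of_nat_diff add_ac)
    then show ?thesis unfolding ce by (simp add: U_def)
  qed
  have R1: "hole_term N (k + 1) e = 2 * U * Q * ((y - x) * ((2 * K + 1) * (x + y + 1 + K) / ((K + 1 + x) * (K + 1 + y))))"
  proof -
    have "hole_term N (k + 1) e = ((K + 1) * cbinom (k + 1)) / cbinom (N + 1 + k) * (U * (y - x)) / ((K + 1 + x) * (K + 1 + y))"
      by (simp add: hole_term_def Nxy U_def K_def add_ac flip: x_def)
    then show ?thesis unfolding ck Q_def using pos by (simp add: divide_simps)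
  qed
  have R2: "hole_term N k e = 2 * U * Q * ((y - x) * (K * (2 * K + 2 * (x + y) + 1) / ((K + x) * (K + y))))"
  proof -
    have Q: "Q = cbinom k / (2 * (2 * K + 2 * (x + y) + 1) * cbinom (k + N))"
      unfolding Q_def cn ..
    have H: "hole_term N k e = K * cbinom k / cbinom (k + N) * (U * (y - x)) / ((K + x) * (K + y))"
      by (simp add: hole_term_def Nxy U_def K_def add_ac flip: x_def)
    have cancel: "K * q / c * (U * d) / z = 2 * U * (q / (2 * w * c)) * (d * (K * w / z))" if "w \<noteq> 0"
      for q c d z w
      using that by simp
    show ?thesis unfolding H Q by (rule cancel) (use pos in auto)
  qed
  have "2 * U * Q * ((x + y + 1 + 2 * K) * (x * (2 * y + 1) / ((x + K) * (y + 1 + K)) - y * (2 * x + 1) / ((x + 1 + K) * (y + K))))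
    = 2 * U * Q * ((y - x) * ((2 * K + 1) * (x + y + 1 + K) / ((K + 1 + x) * (K + 1 + y)) - K * (2 * K + 2 * (x + y) + 1) / ((K + x) * (K + y))))"
    using hole_term_identity[OF pos(1-4)] by (simp only:)
  then show ?thesis
    unfolding L1 L2 R1 R2 by (simp only: right_diff_distrib mult.assoc)
qed

text \<open>Treated separately because the closed form \<open>kernel_term_eq\<close> reads 0/0 at
  \<open>k = 0\<close> when \<open>e = 0\<close> or \<open>e = N\<close>. The pattern persists:
  \<open>hole_term N 0 e\<close> is 0, so this starts the telescoping in \<open>k\<close>.\<close>

lemma kernel_term_diff_0:
  assumes "e \<le> N"
  shows "kernel_term (N + 1) e 0 - kernel_term (N + 1) (e + 1) 0 = hole_term N 1 e"
proof -
  define x where "x = real e"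
  define y where "y = real (N - e)"
  have pos: "x + 1 > 0" "y + 1 > 0" by (simp_all add: x_def y_def)
  have ce: "cbinom (e + 1) = 2 * (2 * x + 1) * cbinom e / (x + 1)"
    using cbinom_Suc[of e] pos by (simp add: x_def field_simps)
  have cy: "cbinom (N + 1 - e) = 2 * (2 * y + 1) * cbinom (N - e) / (y + 1)"
    using cbinom_Suc[of "N - e"] pos assms by (simp add: y_def field_simps Suc_diff_le)
  have Nxy: "real N = x + y" using assms by (simp add: x_def y_def of_nat_diff)
  have "cbinom 1 = 2" by (simp add: cbinom_def)
  moreover have "cbinom (Suc 0) = 2" by (simp add: cbinom_def)
  ultimately have R: "hole_term N 1 e = 2 / cbinom (N + 1) * (cbinom e * cbinom (N - e) * (y - x)) / ((x + 1) * (y + 1))"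
    by (simp add: hole_term_def Nxy add_ac flip: x_def)
  have ident: "a * (2 * (2 * y + 1) * b / (y + 1)) / c - 2 * (2 * x + 1) * a / (x + 1) * b / c
    = 2 / c * (a * b * (y - x)) / ((x + 1) * (y + 1))" if "c \<noteq> 0" for a b c :: real
  proof -
    have "a * (2 * (2 * y + 1) * b / (y + 1)) / c - 2 * (2 * x + 1) * a / (x + 1) * b / c
      = 2 * a * b / c * ((2 * y + 1) / (y + 1) - (2 * x + 1) / (x + 1))"
      by (simp add: algebra_simps)
    also have "(2 * y + 1) / (y + 1) - (2 * x + 1) / (x + 1) = (y - x) / ((x + 1) * (y + 1))"
      using pos by (simp add: divide_simps) (simp add: algebra_simps)
    finally show ?thesis by simp
  qed
  have "N + 1 - (e + 1) = N - e" by simp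
  then show ?thesis
    unfolding kernel_term_0 R cy ce using ident[of "cbinom (N + 1)" "cbinom e" "cbinom (N - e)"] by simp
qed

lemma sum_kernel_term_diff:
  assumes "e \<le> N"
  shows "(\<Sum>k<Suc m. kernel_term (N + 1) e k - kernel_term (N + 1) (e + 1) k) = hole_term N (Suc m) e"
proof (induction m)
  case 0
  then show ?case using kernel_term_diff_0[OF assms] by simp
next
  case (Suc m)
  then show ?case using kernel_term_diff[of "Suc m" e N] assms by simp
qed

text \<open>The anchor of the summation over \<open>l\<close>. In terms of paths, at
  \<open>l = 0\<close> the forbidden vertex is a starting point, so no family avoids it and the
  kernel sum must be 1.\<close>

lemma kernel_term_left: "kernel_term n 0 k = (if k = 0 then 1 else 0)"
proof (cases "k = 0")
  case False
  then have "jac_moment n k (n - 0) = 0"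
    using jac_moment_eq_0[of 0 k n] by simp
  then show ?thesis using False by (simp add: kernel_term_def)
qed (simp add: kernel_term_0)

lemma one_minus_sum_kernel_term:
  assumes "l \<le> N + 1" "m \<ge> 1"
  shows "1 - (\<Sum>k<m. kernel_term (N + 1) l k) = (\<Sum>e<l. hole_term N m e)"
  using assms
proof (induction l)
  case 0
  then show ?case by (simp add: kernel_term_left)
next
  case (Suc l)
  have "(\<Sum>k<m. kernel_term (N + 1) l k) - (\<Sum>k<m. kernel_term (N + 1) (l + 1) k) = hole_term N m l"
    using sum_kernel_term_diff[of l N "m - 1"] Suc.prems by (simp add: sum_subtractf)
  then show ?case using Suc by simp
qed

section \<open>Translation into the stated formula\<close>

text \<open>Both sides are 1 at \<open>e = 0\<close> and have the same quotient of consecutive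
  terms, namely \<open>(y + 1) * (2 * e + 1) / ((e + 1) * (2 * y + 1))\<close> with
  \<open>y = N - e - 1\<close>.\<close>

lemma hole_ratio:
  assumes "e \<le> N"
  shows "(- 1) ^ e * real (N choose e) * pochhammer (1 / 2) e / pochhammer (1 / 2 - real N) e
    = cbinom e * cbinom (N - e) / cbinom N"
  using assms
proof (induction e)
  case (Suc e)
  define y where "y = real N - real e - 1"
  have y: "y \<ge> 0" using Suc.prems by (simp add: y_def)
  have N: "N - e = Suc (N - Suc e)" using Suc.prems by simp
  have cy: "cbinom (N - e) = 2 * (2 * y + 1) * cbinom (N - Suc e) / (y + 1)"
    using cbinom_Suc[of "N - Suc e"] y Suc.prems unfolding N by (simp add: y_def of_nat_diff field_simps)
  have ce: "cbinom (Suc e) = 2 * (2 * real e + 1) * cbinom e / (real e + 1)"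
    using cbinom_Suc[of e] by (simp add: field_simps)
  have ch: "real (N choose Suc e) = real (N choose e) * (y + 1) / (real e + 1)"
  proof -
    have "real (Suc e) * real (N choose Suc e) = real (N - e) * real (N choose e)"
      by (metis binomial_absorb_comp binomial_absorption of_nat_mult)
    then show ?thesis using Suc.prems by (simp add: y_def of_nat_diff field_simps)
  qed
  have nz: "pochhammer (1 / 2 - real N) e \<noteq> 0"
  proof
    assume "pochhammer (1 / 2 - real N) e = 0"
    then obtain i where "i < e" "1 / 2 - real N = - real i" by (auto simp: pochhammer_eq_0_iff)
    then show False using Suc.prems by simp
  qed
  have p: "pochhammer (1 / 2 - real N) (Suc e) = pochhammer (1 / 2 - real N) e * (- (2 * y + 1) / 2)"
    by (simp add: pochhammer_Suc y_def field_simps)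
  have "(- 1) ^ Suc e * real (N choose Suc e) * pochhammer (1 / 2) (Suc e) / pochhammer (1 / 2 - real N) (Suc e)
      = ((- 1) ^ e * real (N choose e) * pochhammer (1 / 2) e / pochhammer (1 / 2 - real N) e)
        * ((y + 1) * (2 * real e + 1) / ((real e + 1) * (2 * y + 1)))"
    unfolding p ch using nz y by (simp add: pochhammer_Suc divide_simps) (simp add: algebra_simps)
  also have "\<dots> = cbinom e * cbinom (N - e) / cbinom N * ((y + 1) * (2 * real e + 1) / ((real e + 1) * (2 * y + 1)))"
    using Suc by simp
  also have "\<dots> = cbinom (Suc e) * cbinom (N - Suc e) / cbinom N"
    unfolding cy ce using y by (simp add: divide_simps) (simp add: algebra_simps)
  finally show ?case .
qed simp

text \<open>The second and the third binomial differ from the more symmetric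
  \<open>(m + N) choose m\<close> and \<open>(2 * (m + N)) choose (2 * m)\<close> by the same factor
  \<open>N / (m + N)\<close>, which cancels.\<close>

lemma hole_coefficient:
  assumes "m \<ge> 1" "N \<ge> 1"
  shows "real m * real ((m + N) choose m) * real ((m + N - 1) choose m) / real ((2 * m + 2 * N - 1) choose (2 * m))
    = real m * cbinom m * cbinom N / cbinom (m + N)"
proof -
  obtain M' N' where eq: "m = Suc M'" "N = Suc N'" using assms by (metis Suc_le_D One_nat_def)
  have f: "real ((a + b) choose a) = fact (a + b) / (fact a * fact b)" for a b
    by (simp add: binomial_fact)
  have c1: "real ((m + N) choose m) = fact (m + N) / (fact m * fact N)"
    by (rule f)
  have c2: "real ((m + N - 1) choose m) = fact (m + N) / (fact m * fact N) * real N / real (m + N)"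
  proof -
    have "fact (m + N) = real (m + N) * (fact (m + N') :: real)" "fact N = real N * (fact N' :: real)"
      using fact_Suc[of "m + N'", where 'a = real] by (simp_all add: eq)
    then show ?thesis using f[of m N'] assms by (simp add: eq del: fact_Suc of_nat_Suc)
  qed
  have c3: "real ((2 * m + 2 * N - 1) choose (2 * m)) = fact (2 * (m + N)) / (fact (2 * m) * fact (2 * N)) * real N / real (m + N)"
  proof -
    have h1: "real ((2 * m + 2 * N - 1) choose (2 * m)) = fact (2 * m + (2 * N' + 1)) / (fact (2 * m) * fact (2 * N' + 1))"
      using f[of "2 * m" "2 * N' + 1"] by (simp add: eq)
    have h2: "fact (2 * (m + N)) = real (2 * (m + N)) * (fact (2 * m + (2 * N' + 1)) :: real)"
      using fact_Suc[of "2 * m + (2 * N' + 1)", where 'a = real] by (simp add: eq)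
    have h3: "fact (2 * N) = real (2 * N) * (fact (2 * N' + 1) :: real)"
      using fact_Suc[of "2 * N' + 1", where 'a = real] by (simp add: eq)
    show ?thesis unfolding h1 h2 h3 using assms by (simp add: divide_simps del: fact_Suc)
  qed
  have c: "cbinom r = fact (2 * r) / (fact r)\<^sup>2" for r
    unfolding cbinom_def using f[of r r] by (simp add: mult_2 power2_eq_square)
  show ?thesis
    unfolding c1 c2 c3 c using assms by (simp add: divide_simps power2_eq_square)
qed

lemma hole_sum_formula:
  assumes "m \<ge> 1" "N \<ge> 1" "1 \<le> l" "l \<le> N"
  shows "real m * real ((m + N) choose m) * real ((m + N - 1) choose m)
      / real ((2 * m + 2 * N - 1) choose (2 * m))
    * (\<Sum>e = 0..l - 1. (- 1) ^ e * real (N choose e) *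
        ((real N - 2 * real e) * pochhammer (1 / 2) e)
          / ((real m + real e) * (real m + real N - real e) * pochhammer (1 / 2 - real N) e))
   = 1 - (\<Sum>k<m. kernel_term (N + 1) l k)"
proof -
  have "{0..l - 1} = {..<l}" using assms by auto
  moreover have "real m * cbinom m * cbinom N / cbinom (m + N) * ((- 1) ^ e * real (N choose e) *
        ((real N - 2 * real e) * pochhammer (1 / 2) e)
          / ((real m + real e) * (real m + real N - real e) * pochhammer (1 / 2 - real N) e)) = hole_term N m e"
    if "e < l" for e
  proof -
    have "(- 1) ^ e * real (N choose e) *
        ((real N - 2 * real e) * pochhammer (1 / 2) e)
          / ((real m + real e) * (real m + real N - real e) * pochhammer (1 / 2 - real N) e)
       = ((- 1) ^ e * real (N choose e) * pochhammer (1 / 2) e / pochhammer (1 / 2 - real N) e)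
          * (real N - 2 * real e) / ((real m + real e) * (real m + real N - real e))"
      by (simp add: mult_ac)
    also have "\<dots> = cbinom e * cbinom (N - e) / cbinom N * (real N - 2 * real e) / ((real m + real e) * (real m + real N - real e))"
      using that assms by (subst hole_ratio) auto
    finally show ?thesis by (simp add: hole_term_def)
  qed
  ultimately show ?thesis
    unfolding hole_coefficient[OF assms(1,2)] using assms
    by (subst one_minus_sum_kernel_term) (simp_all add: sum_distrib_left)
qed

section \<open>Determinants of binomial coefficients\<close>

text \<open>The coefficient of \<open>z ^ k\<close> in \<open>(1 + z) ^ t\<close>. Integer
  \<open>k\<close> makes path counts valid without range conditions. Since
  \<open>D = (1 + z) ^ 2 / z\<close>, the value \<open>ibin (2 * t) (t + k)\<close> is the
  coefficient of \<open>z ^ k\<close> in \<open>D ^ t\<close>.\<close>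

definition ibin :: "nat \<Rightarrow> int \<Rightarrow> real" where
  "ibin t k = (if k < 0 then 0 else real (t choose nat k))"

lemma ibin_0: "ibin 0 k = (if k = 0 then 1 else 0)"
  by (auto simp: ibin_def nat_eq_iff binomial_eq_0)

lemma ibin_Suc: "ibin (Suc t) k = ibin t k + ibin t (k - 1)"
proof (cases "k \<le> 0")
  case False
  then have "nat k = Suc (nat (k - 1))" by simp
  then show ?thesis using False by (simp add: ibin_def)
qed (auto simp: ibin_def)

lemma ibin_of_nat: "ibin t (int k) = real (t choose k)"
  by (simp add: ibin_def)

lemma ibin_eq_0: "k > int t \<Longrightarrow> ibin t k = 0" "k < 0 \<Longrightarrow> ibin t k = 0"
  by (auto simp: ibin_def binomial_eq_0)

lemma ibin_symmetric: "ibin t (int t - k) = ibin t k"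
proof (cases "0 \<le> k \<and> k \<le> int t")
  case True
  then have "nat (int t - k) = t - nat k" "nat k \<le> t" by auto
  then show ?thesis using True binomial_symmetric[of "nat k" t] by (simp add: ibin_def)
qed (auto simp: ibin_eq_0)

lemma ibin_even_symmetric: "ibin (2 * t) (int t - k) = ibin (2 * t) (int t + k)"
  using ibin_symmetric[of "2 * t" "int t + k"] by (simp add: algebra_simps)

text \<open>Multiplication of \<open>D ^ t\<close> by \<open>D = z + 2 + 1/z\<close>.\<close>

lemma ibin_even_Suc:
  "ibin (2 * Suc t) (int (Suc t) + k) = ibin (2 * t) (int t + (k - 1)) + 2 * ibin (2 * t) (int t + k) + ibin (2 * t) (int t + (k + 1))"
proof -
  have "2 * Suc t = Suc (Suc (2 * t))" by simp
  then show ?thesis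
    by (simp only: ibin_Suc) (simp add: algebra_simps)
qed

lemma ibin_vandermonde: "(\<Sum>s\<le>q. real (q choose s) * ibin t (x - int s)) = ibin (t + q) x"
proof (induction q arbitrary: x)
  case (Suc q)
  have "(\<Sum>s\<le>Suc q. real (Suc q choose s) * ibin t (x - int s))
      = ibin t x + (\<Sum>s\<le>q. real (q choose s) * ibin t (x - 1 - int s)) + (\<Sum>s\<le>q. real (q choose Suc s) * ibin t (x - int (Suc s)))"
    by (subst sum.atMost_Suc_shift) (simp add: sum.distrib algebra_simps)
  also have "ibin t x + (\<Sum>s\<le>q. real (q choose s) * ibin t (x - 1 - int s)) + (\<Sum>s\<le>q. real (q choose Suc s) * ibin t (x - int (Suc s)))
      = (\<Sum>s\<le>Suc q. real (q choose s) * ibin t (x - int s)) + (\<Sum>s\<le>q. real (q choose s) * ibin t (x - 1 - int s))"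
    by (subst sum.atMost_Suc_shift) simp
  also have "\<dots> = ibin (t + q) x + ibin (t + q) (x - 1)"
    by (simp add: Suc.IH)
  finally show ?case by (simp add: ibin_Suc)
qed simp

text \<open>The coefficient of \<open>z ^ x\<close> in \<open>D ^ a * D ^ k\<close>. The exponents
  of \<open>D ^ k\<close> run from \<open>-k\<close> to \<open>k\<close>, and \<open>k < m\<close>
  puts them all inside the window of \<open>2 * m - 1\<close> indices centred at
  \<open>m - 1\<close>; \<open>d\<close> is the margin on either side.\<close>

lemma ibin_convolution:
  assumes "k < m"
  shows "(\<Sum>j<2 * m - 1. ibin (2 * a) (int a + int j - int (m - 1) - x) * ibin (2 * k) (int k + int j - int (m - 1)))
    = ibin (2 * (a + k)) (int (a + k) + x)"
proof -
  define d where "d = m - 1 - k"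
  have d: "m - 1 = d + k" "2 * m - 1 = Suc (2 * d + 2 * k)" using assms by (auto simp: d_def)
  have "(\<Sum>j<2 * m - 1. ibin (2 * a) (int a + int j - int (m - 1) - x) * ibin (2 * k) (int k + int j - int (m - 1)))
     = (\<Sum>j\<in>{d..d + 2 * k}. ibin (2 * a) (int a + int j - int (d + k) - x) * ibin (2 * k) (int k + int j - int (d + k)))"
    unfolding d by (intro sum.mono_neutral_right) (auto simp: ibin_eq_0)
  also have "\<dots> = (\<Sum>s\<le>2 * k. ibin (2 * a) (int a + int (s + d) - int (d + k) - x) * ibin (2 * k) (int k + int (s + d) - int (d + k)))"
    using sum.shift_bounds_cl_nat_ivl[of "\<lambda>j. ibin (2 * a) (int a + int j - int (d + k) - x) * ibin (2 * k) (int k + int j - int (d + k))" 0 d "2 * k"]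
    by (simp only: add_0_left atMost_atLeast0 add.commute[of d])
  also have "\<dots> = (\<Sum>s\<le>2 * k. real ((2 * k) choose s) * ibin (2 * a) (int a - ((int k + x) - int s)))"
  proof (intro sum.cong refl)
    fix s
    have "int k + int (s + d) - int (d + k) = int s" "int a + int (s + d) - int (d + k) - x = int a - ((int k + x) - int s)"
      by simp_all
    then show "ibin (2 * a) (int a + int (s + d) - int (d + k) - x) * ibin (2 * k) (int k + int (s + d) - int (d + k))
       = real ((2 * k) choose s) * ibin (2 * a) (int a - ((int k + x) - int s))"
      by (simp only: ibin_of_nat mult.commute)
  qed
  \<comment> \<open>The reflection symmetry of \<open>D ^ a\<close> turns the correlation of the two
    coefficient sequences into their convolution.\<close>
  also have "\<dots> = (\<Sum>s\<le>2 * k. real ((2 * k) choose s) * ibin (2 * a) (int a + (int k + x) - int s))"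
    by (simp only: ibin_even_symmetric) (simp add: algebra_simps)
  also have "\<dots> = ibin (2 * (a + k)) (int (a + k) + x)"
    by (subst ibin_vandermonde) (simp add: algebra_simps)
  finally show ?thesis .
qed

text \<open>Here \<open>g r x\<close> plays the coefficient of \<open>z ^ x\<close> in
  \<open>D ^ r\<close> times a symmetric Laurent polynomial. Knowing the constant terms for all
  \<open>r < m\<close>, the recursion can be solved outwards for the coefficient at
  \<open>x + 1\<close>, at the price of one value of \<open>r\<close> per step.\<close>

lemma even_recursion_eq_0:
  fixes g :: "nat \<Rightarrow> int \<Rightarrow> real"
  assumes rec: "\<And>r x. g (Suc r) x = g r (x - 1) + 2 * g r x + g r (x + 1)"
    and even: "\<And>r x. g r (- x) = g r x"
    and zero: "\<And>r. r < m \<Longrightarrow> g r 0 = 0"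
    and "nat \<bar>x\<bar> + r < m"
  shows "g r x = 0"
proof -
  have *: "g r (int y) = 0" if "y + r < m" for y r
    using that
  proof (induction y arbitrary: r rule: less_induct)
    case (less y)
    show ?case
    proof (cases y)
      case (Suc y')
      have "g (Suc r) (int y') = g r (int y' - 1) + 2 * g r (int y') + g r (int y' + 1)"
        by (rule rec)
      moreover have "g (Suc r) (int y') = 0" "g r (int y') = 0"
        using less Suc by auto
      \<comment> \<open>At \<open>y' = 0\<close> evenness identifies the two outer terms, so the
        recursion gives twice the wanted value.\<close>
      moreover have "g r (int y' - 1) = (if y' = 0 then g r (int y' + 1) else 0)"
        using less.IH[of "y' - 1" r] less.prems Suc even[of r 1] by (auto simp: of_nat_diff)
      ultimately show ?thesis using Suc by (auto split: if_splits simp: add.commute)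
    qed (use zero less in auto)
  qed
  show ?thesis
    using *[of "nat \<bar>x\<bar>" r] assms(4) even[of r x] by (cases "x \<ge> 0") auto
qed

section \<open>Rank-one updates and the path matrix\<close>

text \<open>The matrix determinant lemma, with the column given as \<open>A v\<close> so that no
  inverse of \<open>A\<close> occurs.\<close>

lemma det_rank_one_update:
  fixes A :: "'a :: field mat"
  assumes "A \<in> carrier_mat n n"
  shows "det (mat n n (\<lambda>(i, j). A $$ (i, j) - (\<Sum>k<n. A $$ (i, k) * v k) * b j)) = det A * (1 - (\<Sum>k<n. b k * v k))"
proof -
  define V where "V = mat n 1 (\<lambda>(i, j). v i)"
  define W where "W = mat 1 n (\<lambda>(i, j). b j)"
  define I where "I = (1\<^sub>m n :: 'a mat)"
  define I1 where "I1 = (1\<^sub>m 1 :: 'a mat)"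
  define C where "C = mat n n (\<lambda>(i, j). (if i = j then 1 else 0) - v i * b j)"
  define S where "S = mat 1 1 (\<lambda>(i, j). 1 - (\<Sum>k<n. b k * v k))"
  have carr [simp]: "V \<in> carrier_mat n 1" "W \<in> carrier_mat 1 n" "I \<in> carrier_mat n n" "I1 \<in> carrier_mat 1 1"
    "C \<in> carrier_mat n n" "S \<in> carrier_mat 1 1"
    by (auto simp: V_def W_def I_def I1_def C_def S_def)
  note carr' [simp] = carr[unfolded One_nat_def]
  have dets: "det I = 1" "det I1 = 1" "det S = 1 - (\<Sum>k<n. b k * v k)"
    by (simp_all add: I_def I1_def S_def det_single)
  have block: "four_block_mat P Q R S \<in> carrier_mat (1 + n) (1 + n)"
    if "P \<in> carrier_mat 1 1" "S \<in> carrier_mat n n" for P Q R S :: "'a mat"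
    using that by (rule four_block_carrier_mat)
  \<comment> \<open>Two block factorisations of the same bordered matrix, eliminating below or to
    the right of the corner. One gives the determinant of \<open>I - v b^T\<close>, the other the
    scalar \<open>1 - b . v\<close>.\<close>
  let ?X = "four_block_mat I1 W V I"
  have "?X = four_block_mat I1 (0\<^sub>m 1 n) V I * four_block_mat I1 W (0\<^sub>m n 1) C"
  proof -
    have "I1 * I1 + 0\<^sub>m 1 n * 0\<^sub>m n 1 = I1" "I1 * W + 0\<^sub>m 1 n * C = W" "V * I1 + I * 0\<^sub>m n 1 = V" "V * W + I * C = I"
      by (rule eq_matI; auto simp: I1_def I_def V_def W_def C_def scalar_prod_def)+
    then show ?thesis
      by (subst mult_four_block_mat[of _ 1 1 _ n _ n _ _ 1 _ n]) auto
  qed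
  then have "det ?X = det (four_block_mat I1 (0\<^sub>m 1 n) V I) * det (four_block_mat I1 W (0\<^sub>m n 1) C)"
    by (simp only: det_mult[OF block block] carr)
  also have "\<dots> = det C"
    by (simp add: det_four_block_mat_upper_right_zero[of _ 1 _ n] det_four_block_mat_lower_left_zero[of _ 1 _ n] dets)
  finally have 1: "det ?X = det C" .
  have "?X = four_block_mat S W (0\<^sub>m n 1) I * four_block_mat I1 (0\<^sub>m 1 n) V I"
  proof -
    have "S * I1 + W * V = I1" "S * 0\<^sub>m 1 n + W * I = W" "0\<^sub>m n 1 * I1 + I * V = V" "0\<^sub>m n 1 * 0\<^sub>m 1 n + I * I = I"
      by (rule eq_matI; auto simp: I1_def I_def V_def W_def S_def scalar_prod_def lessThan_atLeast0)+
    then show ?thesis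
      by (subst mult_four_block_mat[of _ 1 1 _ n _ n _ _ 1 _ n]) auto
  qed
  then have "det ?X = det (four_block_mat S W (0\<^sub>m n 1) I) * det (four_block_mat I1 (0\<^sub>m 1 n) V I)"
    by (simp only: det_mult[OF block block] carr)
  also have "\<dots> = 1 - (\<Sum>k<n. b k * v k)"
    by (simp add: det_four_block_mat_upper_right_zero[of _ 1 _ n] det_four_block_mat_lower_left_zero[of _ 1 _ n] dets)
  finally have 2: "det C = 1 - (\<Sum>k<n. b k * v k)" using 1 by simp
  have "mat n n (\<lambda>(i, j). A $$ (i, j) - (\<Sum>k<n. A $$ (i, k) * v k) * b j) = A * C"
    using assms
    by (intro eq_matI) (auto simp: C_def scalar_prod_def right_diff_distrib sum_subtractf sum_distrib_right mult.assoc
       lessThan_atLeast0 if_distrib[of "\<lambda>z. _ * z"] cong: if_cong)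
  then show ?thesis using 2 assms by (simp add: det_mult[of A n C])
qed

text \<open>The entry counts paths with \<open>2 * n\<close> steps of 0 or 1 from height
  \<open>i\<close> to height \<open>n + j\<close>. It is also the coefficient of
  \<open>z ^ (j - i)\<close> in \<open>D ^ n\<close>.\<close>

definition path_mat :: "nat \<Rightarrow> nat \<Rightarrow> real mat" where
  "path_mat n M = mat M M (\<lambda>(i, j). ibin (2 * n) (int n + int j - int i))"

lemma det_path_mat_avoiding:
  assumes "n \<ge> 1" "m \<ge> 1" "l \<le> n"
  shows "det (mat (2 * m - 1) (2 * m - 1) (\<lambda>(i, j). ibin (2 * n) (int n + int j - int i)
      - ibin (2 * l) (int (m - 1 + l) - int i) * ibin (2 * (n - l)) (int n + int j - int (m - 1 + l))))
    = det (path_mat n (2 * m - 1)) * (1 - (\<Sum>k<m. kernel_term n l k))"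
proof -
  obtain p where p: "\<And>j. j < m \<Longrightarrow> (\<Sum>i<m. p i * cbinom (n + i + j)) = cbinom (l + j)"
    and p': "(\<Sum>i<m. p i * cbinom (n - l + i)) = (\<Sum>k<m. kernel_term n l k)"
    using hankel_solution[OF assms(1)] by blast
  define M where "M = 2 * m - 1"
  \<comment> \<open>The coefficients of \<open>p(D)\<close>, with exponent 0 placed at the middle
    index \<open>m - 1\<close>.\<close>
  define v where "v j = (\<Sum>k<m. p k * ibin (2 * k) (int k + int j - int (m - 1)))" for j
  define b where "b j = ibin (2 * (n - l)) (int n + int j - int (m - 1 + l))" for j
  have conv: "(\<Sum>j<M. ibin (2 * a) (int a + int j - int (m - 1) - x) * v j) = (\<Sum>k<m. p k * ibin (2 * (a + k)) (int (a + k) + x))"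
    for a x
  proof -
    have "(\<Sum>j<M. ibin (2 * a) (int a + int j - int (m - 1) - x) * v j)
      = (\<Sum>k<m. p k * (\<Sum>j<M. ibin (2 * a) (int a + int j - int (m - 1) - x) * ibin (2 * k) (int k + int j - int (m - 1))))"
      unfolding v_def sum_distrib_left by (subst sum.swap) (simp add: mult_ac)
    also have "\<dots> = (\<Sum>k<m. p k * ibin (2 * (a + k)) (int (a + k) + x))"
      by (intro sum.cong refl) (simp only: M_def ibin_convolution lessThan_iff)
    finally show ?thesis .
  qed
  have ib: "ibin (2 * r) (int r) = cbinom r" for r
    using ibin_of_nat[of "2 * r" r] by (simp add: cbinom_def)
  \<comment> \<open>The coefficient of \<open>z ^ x\<close> in
    \<open>D ^ r * (D ^ n * p(D) - D ^ l)\<close>. Its constant terms for \<open>r < m\<close>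
    vanish by the Hankel equations.\<close>
  define g where "g r x = (\<Sum>k<m. p k * ibin (2 * (n + k + r)) (int (n + k + r) + x)) - ibin (2 * (l + r)) (int (l + r) + x)" for r x
  have g0: "g r x = 0" if "nat \<bar>x\<bar> + r < m" for r x
    using that
  proof (rule even_recursion_eq_0[rotated -1])
    show "g (Suc r) x = g r (x - 1) + 2 * g r x + g r (x + 1)" for r x
      unfolding g_def add_Suc_right ibin_even_Suc by (simp add: sum.distrib sum_distrib_left algebra_simps)
    show "g r (- x) = g r x" for r x
      by (simp only: g_def add_uminus_conv_diff ibin_even_symmetric)
    show "g r 0 = 0" if "r < m" for r
      using p[OF that] by (simp only: g_def ib add_0_right diff_self)
  qed
  have a: "(\<Sum>k<M. path_mat n M $$ (i, k) * v k) = ibin (2 * l) (int (m - 1 + l) - int i)" if "i < M" for i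
  proof -
    define x where "x = int i - int (m - 1)"
    have "(\<Sum>k<M. path_mat n M $$ (i, k) * v k) = (\<Sum>j<M. ibin (2 * n) (int n + int j - int (m - 1) - x) * v j)"
    proof (intro sum.cong refl)
      fix j assume "j \<in> {..<M}"
      moreover have "int n + int j - int (m - 1) - x = int n + int j - int i" by (simp add: x_def)
      ultimately show "path_mat n M $$ (i, j) * v j = ibin (2 * n) (int n + int j - int (m - 1) - x) * v j"
        using that by (simp only: path_mat_def) simp
    qed
    also have "\<dots> = ibin (2 * l) (int l + x)"
    proof -
      have "nat \<bar>x\<bar> + 0 < m" using that by (auto simp: x_def M_def)
      from g0[OF this] show ?thesis
        unfolding conv[of n x] by (simp only: g_def add_0_right right_minus_eq)
    qed
    also have "\<dots> = ibin (2 * l) (int (m - 1 + l) - int i)"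
      using ibin_even_symmetric[of l x] by (simp add: x_def algebra_simps)
    finally show ?thesis .
  qed
  \<comment> \<open>The sequence \<open>b\<close> holds the coefficients of
    \<open>D ^ (n - l)\<close> around the middle index, so this is the constant term of
    \<open>D ^ (n - l) * p(D)\<close>.\<close>
  have bv: "(\<Sum>k<M. b k * v k) = (\<Sum>k<m. kernel_term n l k)"
  proof -
    have "(\<Sum>k<M. b k * v k) = (\<Sum>j<M. ibin (2 * (n - l)) (int (n - l) + int j - int (m - 1) - 0) * v j)"
      using assms by (intro sum.cong) (auto simp: b_def of_nat_diff algebra_simps)
    then show ?thesis unfolding conv using p' by (simp only: ib add_0_right)
  qed
  have "mat M M (\<lambda>(i, j). ibin (2 * n) (int n + int j - int i)
      - ibin (2 * l) (int (m - 1 + l) - int i) * ibin (2 * (n - l)) (int n + int j - int (m - 1 + l)))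
     = mat M M (\<lambda>(i, j). path_mat n M $$ (i, j) - (\<Sum>k<M. path_mat n M $$ (i, k) * v k) * b j)"
    by (rule eq_matI) (simp_all add: a b_def, simp add: path_mat_def)
  then show ?thesis
    unfolding M_def[symmetric] using det_rank_one_update[of "path_mat n M" M v b] bv
    by (simp add: path_mat_def)
qed

section \<open>MacMahon's determinant and product\<close>

text \<open>Multiplying by the unitriangular Pascal matrix \<open>T\<close> makes the upper index
  depend on the column. The entry is then a row factor times a column factor times
  \<open>(n + j) choose i\<close>, and the last matrix has an explicit LU factorisation.\<close>

lemma det_path_mat: "det (path_mat n M) = (\<Prod>j<M. fact (2 * n + j) * fact j / (fact (n + j))\<^sup>2)"
proof -
  define T where "T = mat M M (\<lambda>(i, j). real (j choose i))"
  define L where "L = mat M M (\<lambda>(i, j). if j \<le> i then fact i / fact (n + i) * real (n choose (i - j)) else 0)"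
  define U where "U = mat M M (\<lambda>(i, j). real (j choose i) * (fact (2 * n + j) / fact (n + j)))"
  have carr [simp]: "T \<in> carrier_mat M M" "L \<in> carrier_mat M M" "U \<in> carrier_mat M M" "path_mat n M \<in> carrier_mat M M"
    by (auto simp: T_def L_def U_def path_mat_def)
  have extend: "(\<Sum>k\<in>{0..<M}. real (j choose k) * f k) = (\<Sum>k\<le>j. real (j choose k) * f k)" if "j < M" for j f
    using that by (intro sum.mono_neutral_right) (auto simp: binomial_eq_0)
  have "path_mat n M * T = L * U"
  proof (rule eq_matI)
    fix i j assume "i < dim_row (L * U)" "j < dim_col (L * U)"
    then have ij: "i < M" "j < M" by (auto simp: L_def U_def)
    have "(path_mat n M * T) $$ (i, j) = (\<Sum>k\<in>{0..<M}. real (j choose k) * ibin (2 * n) (int n + int k - int i))"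
      using ij by (simp add: path_mat_def T_def scalar_prod_def mult.commute)
    also have "\<dots> = (\<Sum>k\<le>j. real (j choose k) * ibin (2 * n) (int n + int k - int i))"
      by (rule extend[OF ij(2)])
    also have "\<dots> = (\<Sum>k\<le>j. real (j choose k) * ibin (2 * n) ((int n + int j - int i) - int k))"
      by (rule sum.reindex_bij_witness[of _ "\<lambda>k. j - k" "\<lambda>k. j - k"])
         (auto simp: binomial_symmetric[symmetric] of_nat_diff algebra_simps)
    also have "\<dots> = ibin (2 * n + j) (int n + int j - int i)"
      by (rule ibin_vandermonde)
    also have "\<dots> = fact i / fact (n + i) * (fact (2 * n + j) / fact (n + j)) * real ((n + j) choose i)"
    proof (cases "i \<le> n + j")
      case True
      then have "ibin (2 * n + j) (int n + int j - int i) = real ((2 * n + j) choose (n + j - i))"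
        by (simp add: ibin_def nat_diff_distrib flip: of_nat_add of_nat_diff)
      also have "\<dots> = fact (2 * n + j) / (fact (n + j - i) * fact (n + i))"
        using True by (subst binomial_fact) (auto intro!: arg_cong[of _ _ fact])
      also have "\<dots> = fact i / fact (n + i) * (fact (2 * n + j) / fact (n + j)) * real ((n + j) choose i)"
        using True by (subst binomial_fact) (auto)
      finally show ?thesis .
    qed (auto simp: ibin_eq_0 binomial_eq_0)
    \<comment> \<open>Vandermonde is the LU factorisation: \<open>n choose (i - k)\<close> is lower
      triangular in \<open>i, k\<close>, and \<open>j choose k\<close> is upper triangular in
      \<open>k, j\<close>.\<close>
    also have "real ((n + j) choose i) = (\<Sum>k\<le>i. real (j choose k) * real (n choose (i - k)))"
      using vandermonde[of j n i] by (simp add: add.commute flip: of_nat_mult of_nat_sum)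
    also have "fact i / fact (n + i) * (fact (2 * n + j) / fact (n + j)) * (\<Sum>k\<le>i. real (j choose k) * real (n choose (i - k)))
       = (\<Sum>k\<le>i. L $$ (i, k) * U $$ (k, j))"
      unfolding sum_distrib_left using ij by (intro sum.cong) (auto simp: L_def U_def)
    also have "\<dots> = (\<Sum>k\<in>{0..<M}. L $$ (i, k) * U $$ (k, j))"
      using ij by (intro sum.mono_neutral_left) (auto simp: L_def)
    also have "\<dots> = (L * U) $$ (i, j)"
      using ij by (simp add: scalar_prod_def L_def U_def)
    finally show "(path_mat n M * T) $$ (i, j) = (L * U) $$ (i, j)" .
  qed (auto simp: L_def U_def T_def path_mat_def)
  then have "det (path_mat n M) * det T = det L * det U"
    by (metis carr det_mult)
  moreover have "det T = 1"
    by (subst det_upper_triangular[of _ M]) (auto simp: T_def diag_mat_def prod.list_conv_set_nth)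
  moreover have "det L = (\<Prod>i<M. fact i / fact (n + i))"
    by (subst det_lower_triangular[of M]) (auto simp: L_def diag_mat_def prod.list_conv_set_nth lessThan_atLeast0)
  moreover have "det U = (\<Prod>j<M. fact (2 * n + j) / fact (n + j))"
    by (subst det_upper_triangular[of _ M]) (auto simp: U_def diag_mat_def prod.list_conv_set_nth lessThan_atLeast0)
  ultimately show ?thesis
    by (simp add: prod.distrib[symmetric] power2_eq_square mult_ac)
qed

text \<open>For fixed \<open>j\<close> and \<open>k\<close> the product over \<open>i\<close>
  telescopes; the product over \<open>j\<close> of what remains is a quotient of four
  factorials.\<close>

lemma macmahon_product:
  "(\<Prod>i = 1..n. \<Prod>j = 1..n. \<Prod>k = 1..M. (real i + real j + real k - 1) / (real i + real j + real k - 2))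
     = (\<Prod>j<M. fact (2 * n + j) * fact j / (fact (n + j))\<^sup>2)"
proof -
  have tele: "(\<Prod>i = 1..n. (real i + x) / (real i + x - 1)) = (real n + x) / x" if "x > 0" for x
  proof (induction n)
    case (Suc n)
    have "real (Suc n) + x - 1 = real n + x" "real n + x \<noteq> 0" using that by auto
    then show ?case using Suc that by (simp add: add_ac)
  qed (use that in auto)
  have inner: "(\<Prod>j = 1..a. (real n + (real j + real k)) / (real j + real k)) = fact (n + a + k) * fact k / (fact (n + k) * fact (a + k))" for a k
    by (induction a) (simp_all add: divide_simps, simp add: algebra_simps)
  \<comment> \<open>Starting \<open>k\<close> at 0 gives the factor the form
    \<open>(i + x) / (i + x - 1)\<close> with \<open>x = j + k\<close>, positive because
    \<open>j \<ge> 1\<close>.\<close>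
  have shift: "(\<Prod>k = 1..M. (real i + real j + real k - 1) / (real i + real j + real k - 2))
      = (\<Prod>k<M. (real i + (real j + real k)) / (real i + (real j + real k) - 1))" for i j
    by (rule prod.reindex_bij_witness[of _ Suc "\<lambda>k. k - 1"]) (auto simp: algebra_simps of_nat_diff)
  have "(\<Prod>i = 1..n. \<Prod>j = 1..n. \<Prod>k = 1..M. (real i + real j + real k - 1) / (real i + real j + real k - 2))
     = (\<Prod>i = 1..n. \<Prod>j = 1..n. \<Prod>k<M. (real i + (real j + real k)) / (real i + (real j + real k) - 1))"
    by (simp only: shift)
  also have "\<dots> = (\<Prod>k<M. \<Prod>j = 1..n. \<Prod>i = 1..n. (real i + (real j + real k)) / (real i + (real j + real k) - 1))"
    by (subst prod.swap, subst (2) prod.swap, subst prod.swap) (rule refl)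
  also have "\<dots> = (\<Prod>k<M. \<Prod>j = 1..n. (real n + (real j + real k)) / (real j + real k))"
    by (intro prod.cong refl tele) auto
  also have "\<dots> = (\<Prod>j<M. fact (2 * n + j) * fact j / (fact (n + j))\<^sup>2)"
    unfolding inner by (simp add: power2_eq_square mult_2)
  finally show ?thesis .
qed

section \<open>Non-intersecting lattice paths\<close>

definition increasing :: "nat \<Rightarrow> (nat \<Rightarrow> int) \<Rightarrow> bool" where
  "increasing M y \<longleftrightarrow> (\<forall>i j. i < j \<longrightarrow> j < M \<longrightarrow> y i < y j)"

text \<open>There is no room to spare: \<open>M\<close> distinct integers fill a window of length
  \<open>M\<close>. This fixes the endpoints in both extreme columns.\<close>

lemma increasing_in_interval:
  assumes "increasing M y" "\<And>j. j < M \<Longrightarrow> a \<le> y j \<and> y j < a + int M" "j < M"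
  shows "y j = a + int j"
proof (rule antisym)
  have "a + int i \<le> y i" if "i < M" for i
    using that
  proof (induction i)
    case (Suc i)
    then have "y i < y (Suc i)" using assms(1) by (auto simp: increasing_def)
    then show ?case using Suc by auto
  qed (use assms in auto)
  then show "a + int j \<le> y j" using assms by auto
  have "y (M - 1 - i) \<le> a + int (M - 1 - i)" if "i < M" for i
    using that
  proof (induction i)
    case 0
    then show ?case using assms(2)[of "M - 1"] by (auto simp: of_nat_diff)
  next
    case (Suc i)
    then have "y (M - 1 - Suc i) < y (M - 1 - i)" using assms(1) by (auto simp: increasing_def)
    then show ?case using Suc by (auto simp: of_nat_diff)
  qed
  from this[of "M - 1 - j"] show "y j \<le> a + int j" using assms(3) by auto
qed

text \<open>\<open>W s x\<close> says whether height \<open>x\<close> is allowed at time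
  \<open>s\<close>. The extensional function spaces fix all values outside the index ranges, so that
  each family is a single element and cardinalities make sense.\<close>

definition path_families :: "nat \<Rightarrow> (nat \<Rightarrow> int \<Rightarrow> bool) \<Rightarrow> nat \<Rightarrow> (nat \<Rightarrow> int) \<Rightarrow> (nat \<Rightarrow> nat \<Rightarrow> int) set" where
  "path_families M W t y = {P \<in> {..t} \<rightarrow>\<^sub>E ({..<M} \<rightarrow>\<^sub>E UNIV).
     (\<forall>j<M. P 0 j = int j) \<and>
     (\<forall>s<t. \<forall>j<M. P (Suc s) j = P s j \<or> P (Suc s) j = P s j + 1) \<and>
     (\<forall>s\<le>t. increasing M (P s)) \<and>
     (\<forall>s\<le>t. \<forall>j<M. W s (P s j)) \<and>
     (\<forall>j<M. P t j = y j)}"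

text \<open>Multilinearity in the columns, via the Leibniz formula with the permutation on the row
  index.\<close>

lemma det_sum_columns:
  fixes f :: "'b \<Rightarrow> nat \<Rightarrow> nat \<Rightarrow> 'a :: comm_ring_1"
  assumes "finite S"
  shows "det (mat n n (\<lambda>(i, j). \<Sum>s\<in>S. f s i j)) = (\<Sum>e\<in>{..<n} \<rightarrow>\<^sub>E S. det (mat n n (\<lambda>(i, j). f (e j) i j)))"
proof -
  have *: "det (mat n n (\<lambda>(i, j). g i j)) = (\<Sum>p | p permutes {0..<n}. signof p * (\<Prod>j<n. g (p j) j))" for g :: "nat \<Rightarrow> nat \<Rightarrow> 'a"
  proof -
    have "det (mat n n (\<lambda>(i, j). g i j)) = det (transpose_mat (mat n n (\<lambda>(i, j). g i j)))"
      by (rule det_transpose[symmetric, of _ n]) simp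
    also have "\<dots> = (\<Sum>p | p permutes {0..<n}. signof p * (\<Prod>j = 0..<n. transpose_mat (mat n n (\<lambda>(i, j). g i j)) $$ (j, p j)))"
      by (rule det_def') simp
    also have "\<dots> = (\<Sum>p | p permutes {0..<n}. signof p * (\<Prod>j<n. g (p j) j))"
    proof (intro sum.cong refl arg_cong2[of _ _ _ _ "(*)"] prod.cong)
      fix p j assume "p \<in> {p. p permutes {0..<n}}" "j \<in> {..<n}"
      then show "transpose_mat (mat n n (\<lambda>(i, j). g i j)) $$ (j, p j) = g (p j) j"
        using permutes_in_image[of p "{0..<n}" j] by auto
    qed auto
    finally show ?thesis .
  qed
  show ?thesis
    unfolding * using assms
    by (subst sum.swap) (simp add: prod_sum_PiE sum_distrib_left)
qed

lemma det_zero_column: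
  fixes A :: "'a :: comm_ring_1 mat"
  assumes "A \<in> carrier_mat n n" "j < n" "\<And>i. i < n \<Longrightarrow> A $$ (i, j) = 0"
  shows "det A = 0"
proof -
  have "det A = det (transpose_mat A)" using assms(1) by (simp add: det_transpose)
  also have "transpose_mat A = mat\<^sub>r n n (\<lambda>i. if i = j then 0\<^sub>v n else row (transpose_mat A) i)"
    using assms by (intro eq_matI) (auto simp: mat_of_rows_def)
  also have "det \<dots> = 0"
    using assms by (intro det_row_0) auto
  finally show ?thesis .
qed

text \<open>The Lindstroem-Gessel-Viennot count, by induction on time with arbitrary end heights
  instead of the usual tail swapping. Undoing the last step expands the determinant by
  multilinearity over all choices of steps. A choice with legal heights is covered by the induction
  hypothesis, any other produces two equal columns.\<close>

lemma card_path_families_eq_det: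
  fixes h :: "nat \<Rightarrow> nat \<Rightarrow> int \<Rightarrow> real"
  assumes h0: "\<And>i x. i < M \<Longrightarrow> h 0 i x = (if x = int i then 1 else 0)"
    and hSuc: "\<And>t i x. i < M \<Longrightarrow> h (Suc t) i x = (if W (Suc t) x then h t i x + h t i (x - 1) else 0)"
    and W0: "\<And>j. j < M \<Longrightarrow> W 0 (int j)"
    and "increasing M y"
  shows "finite (path_families M W t y) \<and> real (card (path_families M W t y)) = det (mat M M (\<lambda>(i, j). h t i (y j)))"
  using assms(4)
proof (induction t arbitrary: y)
  case 0
  show ?case
  proof (cases "\<forall>j<M. y j = int j")
    case True
    have "path_families M W 0 y = {\<lambda>s\<in>{..0::nat}. \<lambda>j\<in>{..<M}. int j}"
    proof (intro Set.set_eqI iffI)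
      fix P assume P: "P \<in> path_families M W 0 y"
      have "P s j = (\<lambda>s\<in>{..0::nat}. \<lambda>j\<in>{..<M}. int j) s j" for s j
        using P True by (cases "s = 0"; cases "j < M") (auto simp: path_families_def PiE_def extensional_def)
      then have "P = (\<lambda>s\<in>{..0::nat}. \<lambda>j\<in>{..<M}. int j)" by (intro ext)
      then show "P \<in> {\<lambda>s\<in>{..0::nat}. \<lambda>j\<in>{..<M}. int j}" by (simp only: singleton_iff)
    next
      fix P assume "P \<in> {\<lambda>s\<in>{..0::nat}. \<lambda>j\<in>{..<M}. int j}"
      then show "P \<in> path_families M W 0 y"
        using True W0 by (auto simp: path_families_def increasing_def)
    qed
    moreover have "mat M M (\<lambda>(i, j). h 0 i (y j)) = 1\<^sub>m M"
      using True by (intro eq_matI) (auto simp: h0)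
    ultimately show ?thesis by simp
  next
    case False
    then have empty: "path_families M W 0 y = {}" by (auto simp: path_families_def)
    \<comment> \<open>Otherwise \<open>increasing_in_interval\<close> would force the end heights to
      be the starting ones. A height outside the window gives a zero column.\<close>
    have "\<exists>j<M. \<not> (0 \<le> y j \<and> y j < 0 + int M)"
    proof (rule ccontr)
      assume "\<not> (\<exists>j<M. \<not> (0 \<le> y j \<and> y j < 0 + int M))"
      then have "y j = 0 + int j" if "j < M" for j
        using increasing_in_interval[OF 0, of 0 j] that by blast
      then show False using False by simp
    qed
    then obtain j where j: "j < M" "\<not> (0 \<le> y j \<and> y j < int M)" by auto
    have "det (mat M M (\<lambda>(i, j). h 0 i (y j))) = 0"
      using j by (intro det_zero_column[of _ M j]) (auto simp: h0)
    then show ?thesis using empty by simp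
  qed
next
  case (Suc t)
  show ?case
  proof (cases "\<forall>j<M. W (Suc t) (y j)")
    case False
    then obtain j where j: "j < M" "\<not> W (Suc t) (y j)" by auto
    have "P \<notin> path_families M W (Suc t) y" for P
    proof
      assume P: "P \<in> path_families M W (Suc t) y"
      then have "\<forall>s\<le>Suc t. \<forall>j<M. W s (P s j)" "P (Suc t) j = y j"
        using j by (simp_all add: path_families_def)
      then show False using j by (metis order_refl)
    qed
    then have "path_families M W (Suc t) y = {}" by blast
    moreover have "det (mat M M (\<lambda>(i, j). h (Suc t) i (y j))) = 0"
      using j by (intro det_zero_column[of _ M j]) (auto simp: hSuc)
    ultimately show ?thesis by simp
  next
    case True
    define D where "D = {..<M} \<rightarrow>\<^sub>E {0, 1 :: int}"
    define sh where "sh e j = y j - e j" for e j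
    define ext where "ext P = P(Suc t := restrict y {..<M})" for P :: "nat \<Rightarrow> nat \<Rightarrow> int"
    define G where "G = {e \<in> D. increasing M (sh e)}"
    have finD: "finite D" by (auto simp: D_def intro: finite_PiE)
    then have finG: "finite G" by (simp add: G_def)
    have D01: "e j = 0 \<or> e j = 1" if "e \<in> D" "j < M" for e j
      using that by (auto simp: D_def PiE_def Pi_def)
    have "mat M M (\<lambda>(i, j). h (Suc t) i (y j)) = mat M M (\<lambda>(i, j). \<Sum>s\<in>{0, 1}. h t i (y j - s))"
      using True by (intro eq_matI) (auto simp: hSuc)
    then have "det (mat M M (\<lambda>(i, j). h (Suc t) i (y j))) = (\<Sum>e\<in>D. det (mat M M (\<lambda>(i, j). h t i (sh e j))))"
      by (simp only: D_def sh_def) (rule det_sum_columns[of "{0, 1}" M "\<lambda>s i j. h t i (y j - s)"], simp)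
    also have "\<dots> = (\<Sum>e\<in>G. det (mat M M (\<lambda>(i, j). h t i (sh e j))))"
    proof (intro sum.mono_neutral_right finD ballI)
      \<comment> \<open>Heights \<open>y i < y j\<close> are lowered by 0 or 1 each, so they can
        become equal but cannot pass each other.\<close>
      fix e assume e: "e \<in> D - G"
      then obtain i j where ij: "i < j" "j < M" "sh e i \<ge> sh e j"
        by (force simp: G_def increasing_def)
      moreover have "y i < y j" using Suc.prems ij by (auto simp: increasing_def)
      moreover have "e i = 0 \<or> e i = 1" "e j = 0 \<or> e j = 1" using D01 e ij by auto
      ultimately have "sh e i = sh e j" by (auto simp: sh_def)
      then show "det (mat M M (\<lambda>(i, j). h t i (sh e j))) = 0"
        using ij by (intro det_identical_columns[of _ M i j]) (auto intro!: eq_vecI)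
    qed (auto simp: G_def)
    also have "\<dots> = (\<Sum>e\<in>G. real (card (path_families M W t (sh e))))"
      using Suc.IH by (intro sum.cong) (auto simp: G_def)
    finally have det: "det (mat M M (\<lambda>(i, j). h (Suc t) i (y j))) = (\<Sum>e\<in>G. real (card (path_families M W t (sh e))))" .
    have inj: "inj_on ext (path_families M W t z)" for z
    proof (rule inj_onI)
      fix P Q assume PQ: "P \<in> path_families M W t z" "Q \<in> path_families M W t z" and eq: "ext P = ext Q"
      have "P s = Q s" for s
      proof (cases "s = Suc t")
        case True
        then show ?thesis using PQ by (auto simp: path_families_def PiE_def extensional_def)
      next
        case False
        then show ?thesis using fun_cong[OF eq, of s] by (simp add: ext_def)
      qed
      then show "P = Q" by auto
    qed
    have fam: "path_families M W (Suc t) y = (\<Union>e\<in>G. ext ` path_families M W t (sh e))"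
    proof (intro Set.set_eqI iffI)
      fix P assume P: "P \<in> path_families M W (Suc t) y"
      define e where "e = (\<lambda>j\<in>{..<M}. P (Suc t) j - P t j)"
      define Q where "Q = restrict P {..t}"
      have she: "sh e j = P t j" if "j < M" for j
        using P that by (auto simp: sh_def e_def path_families_def)
      have "increasing M (P t)" using P by (auto simp: path_families_def)
      then have "increasing M (sh e)" using she by (auto simp: increasing_def)
      moreover have "P (Suc t) j = P t j \<or> P (Suc t) j = P t j + 1" if "j < M" for j
        using P that unfolding path_families_def by blast
      then have "e \<in> D" by (force simp: D_def e_def)
      ultimately have "e \<in> G" by (simp add: G_def)
      moreover have "Q \<in> path_families M W t (sh e)"
        using P she by (auto simp: Q_def path_families_def PiE_def Pi_def)
      moreover have "P = ext Q"
      proof (intro ext)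
        fix s j
        have 1: "P (Suc t) j = restrict y {..<M} j" for j
          using P by (auto simp: path_families_def PiE_def Pi_def extensional_def)
        have 2: "s > Suc t \<Longrightarrow> P s = undefined"
          using P by (auto simp: path_families_def PiE_def extensional_def)
        show "P s j = ext Q s j"
          using 1 2 by (cases "s \<le> t"; cases "s = Suc t") (auto simp: ext_def Q_def)
      qed
      ultimately show "P \<in> (\<Union>e\<in>G. ext ` path_families M W t (sh e))" by blast
    next
      fix P assume "P \<in> (\<Union>e\<in>G. ext ` path_families M W t (sh e))"
      then obtain e Q where e: "e \<in> G" and Q: "Q \<in> path_families M W t (sh e)" and P: "P = ext Q" by auto
      have Ps: "P s = Q s" if "s \<le> t" for s using that by (simp add: P ext_def)
      have PS: "P (Suc t) = restrict y {..<M}" by (simp add: P ext_def)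
      have e01: "e j = 0 \<or> e j = 1" if "j < M" for j using D01 e that by (auto simp: G_def)
      have "P \<in> {..Suc t} \<rightarrow>\<^sub>E ({..<M} \<rightarrow>\<^sub>E UNIV)"
      proof (rule PiE_I)
        fix s assume "s \<in> {..Suc t}"
        then show "P s \<in> {..<M} \<rightarrow>\<^sub>E UNIV"
          using Q PS Ps[of s] by (cases "s = Suc t") (auto simp: path_families_def PiE_def Pi_def)
      next
        fix s assume "s \<notin> {..Suc t}"
        then show "P s = undefined"
          using Q by (auto simp: P ext_def path_families_def PiE_def extensional_def)
      qed
      moreover have "P 0 j = int j" if "j < M" for j
        using Q that Ps[of 0] by (auto simp: path_families_def)
      moreover have "P (Suc s) j = P s j \<or> P (Suc s) j = P s j + 1" if "s < Suc t" "j < M" for s j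
      proof (cases "s = t")
        case True
        have "Q t j = sh e j" using Q that by (auto simp: path_families_def)
        then show ?thesis using True PS Ps[of t] e01[of j] that by (auto simp: sh_def)
      next
        case False
        then show ?thesis using Q that Ps[of s] Ps[of "Suc s"] by (auto simp: path_families_def)
      qed
      moreover have "increasing M (P s)" if "s \<le> Suc t" for s
      proof (cases "s = Suc t")
        case True
        then show ?thesis using PS Suc.prems by (auto simp: increasing_def)
      next
        case False
        then show ?thesis using Q Ps[of s] that by (auto simp: path_families_def)
      qed
      moreover have "W s (P s j)" if "s \<le> Suc t" "j < M" for s j
        using Q Ps[of s] that PS True by (cases "s = Suc t") (auto simp: path_families_def)
      moreover have "P (Suc t) j = y j" if "j < M" for j
        using that by (simp add: PS)
      ultimately show "P \<in> path_families M W (Suc t) y"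
        by (simp add: path_families_def)
    qed
    have disj: "ext ` path_families M W t (sh e) \<inter> ext ` path_families M W t (sh e') = {}"
      if "e \<in> G" "e' \<in> G" "e \<noteq> e'" for e e'
    proof (rule ccontr)
      assume "ext ` path_families M W t (sh e) \<inter> ext ` path_families M W t (sh e') \<noteq> {}"
      then obtain P Q where PQ: "P \<in> path_families M W t (sh e)" "Q \<in> path_families M W t (sh e')" and eq: "ext P = ext Q"
        by auto
      have "P t = Q t" using fun_cong[OF eq, of t] by (simp add: ext_def)
      then have "e j = e' j" if "j < M" for j
        using PQ that by (auto simp: path_families_def sh_def)
      then have "e = e'" using that(1,2) by (intro PiE_ext[of _ "{..<M}"]) (auto simp: G_def D_def)
      then show False using that by simp
    qed
    have fin: "finite (path_families M W t (sh e))" if "e \<in> G" for e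
      using Suc.IH that by (auto simp: G_def)
    have "card (path_families M W (Suc t) y) = (\<Sum>e\<in>G. card (ext ` path_families M W t (sh e)))"
      unfolding fam using finG fin disj by (intro card_UN_disjoint) auto
    also have "\<dots> = (\<Sum>e\<in>G. card (path_families M W t (sh e)))"
      by (intro sum.cong refl card_image inj)
    finally show ?thesis
      using det finG fin by (simp add: fam)
  qed
qed

lemma card_path_families_avoiding:
  assumes "1 \<le> l" "l \<le> n"
  shows "real (card (path_families M (\<lambda>s x. \<not> (s = 2 * l \<and> x = c)) (2 * n) (\<lambda>j. int n + int j)))
    = det (mat M M (\<lambda>(i, j). ibin (2 * n) (int n + int j - int i)
        - ibin (2 * l) (c - int i) * ibin (2 * (n - l)) (int n + int j - c)))"
proof -
  \<comment> \<open>All paths from \<open>i\<close> to \<open>x\<close>, minus those through height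
    \<open>c\<close> at time \<open>2 * l\<close>. At the final time the subtracted part has rank
    one.\<close>
  define h where "h t i x = ibin t (x - int i) - (if 2 * l \<le> t then ibin (2 * l) (c - int i) * ibin (t - 2 * l) (x - c) else 0)"
    for t i x
  have "real (card (path_families M (\<lambda>s x. \<not> (s = 2 * l \<and> x = c)) (2 * n) (\<lambda>j. int n + int j)))
    = det (mat M M (\<lambda>(i, j). h (2 * n) i (int n + int j)))"
  proof (intro card_path_families_eq_det[THEN conjunct2])
    show "h 0 i x = (if x = int i then 1 else 0)" for i x
      using assms by (simp add: h_def ibin_0)
    show "h (Suc t) i x = (if \<not> (Suc t = 2 * l \<and> x = c) then h t i x + h t i (x - 1) else 0)" for t i x
    proof (cases "2 * l \<le> t")
      case True
      then have "Suc t - 2 * l = Suc (t - 2 * l)" by simp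
      moreover have "Suc t \<noteq> 2 * l" using True by simp
      ultimately show ?thesis using True by (simp add: h_def ibin_Suc algebra_simps)
    next
      case False
      show ?thesis
      proof (cases "Suc t = 2 * l")
        case True
        \<comment> \<open>At time \<open>2 * l\<close> the factor \<open>ibin 0 (x - c)\<close> is a
          Kronecker delta, so the subtraction cancels exactly the count at \<open>c\<close>.\<close>
        show ?thesis unfolding h_def True[symmetric] by (auto simp: ibin_0 ibin_Suc algebra_simps)
      next
        case False
        with \<open>\<not> 2 * l \<le> t\<close> have "\<not> 2 * l \<le> Suc t" by simp
        then show ?thesis using \<open>\<not> 2 * l \<le> t\<close> False by (simp add: h_def ibin_Suc[of t] algebra_simps)
      qed
    qed
    show "\<not> (0 = 2 * l \<and> int j = c)" for j using assms by simp
    show "increasing M (\<lambda>j. int n + int j)" by (simp add: increasing_def)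
  qed
  moreover have "2 * n - 2 * l = 2 * (n - l)" by simp
  ultimately show ?thesis using assms by (simp add: h_def)
qed

section \<open>Perfect matchings of unit triangles\<close>

text \<open>A vertical unit edge of the lattice in the hexagon is encoded by its column \<open>t\<close> and its
  position \<open>y\<close>, counted downwards. The edge \<open>(t, y)\<close> also stands for the triangle to its right
  (if \<open>t < 2 * n\<close>) and for the triangle to its left (if \<open>t > 0\<close>).\<close>

definition sites :: "nat \<Rightarrow> nat \<Rightarrow> (nat \<times> int) set" where
  "sites n M = {(t, y). t \<le> 2 * n \<and> 0 \<le> y \<and> int t - int n \<le> y \<and> y < int M + int t \<and> y < int M + int n}"

text \<open>\<open>u\<close> is read as the triangle to the right of its edge, \<open>d\<close> as
  the triangle to the left of its edge. For \<open>d = u\<close> they share that vertical edge and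
  the rhombus has a horizontal long diagonal. In the other two cases they share a slanted edge, and
  the rhombus is one step of a path.\<close>

definition adjacent :: "nat \<times> int \<Rightarrow> nat \<times> int \<Rightarrow> bool" where
  "adjacent u d \<longleftrightarrow> d = u \<or> fst d = Suc (fst u) \<and> (snd d = snd u \<or> snd d = snd u + 1)"

definition site_pairs :: "nat \<Rightarrow> nat \<Rightarrow> ((nat \<times> int) \<times> (nat \<times> int)) set" where
  "site_pairs n M = {(u, d). u \<in> sites n M \<and> fst u < 2 * n \<and> d \<in> sites n M \<and> 0 < fst d \<and> adjacent u d}"

definition matchings :: "nat \<Rightarrow> nat \<Rightarrow> ((nat \<times> int) \<times> (nat \<times> int)) set set" where
  "matchings n M = {\<mu>. \<mu> \<subseteq> site_pairs n M \<and>
     (\<forall>u\<in>sites n M. fst u < 2 * n \<longrightarrow> (\<exists>!d. (u, d) \<in> \<mu>)) \<and>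
     (\<forall>d\<in>sites n M. 0 < fst d \<longrightarrow> (\<exists>!u. (u, d) \<in> \<mu>))}"

section \<open>Path families and perfect matchings\<close>

abbreviation full_families :: "nat \<Rightarrow> nat \<Rightarrow> (nat \<Rightarrow> nat \<Rightarrow> int) set" where
  "full_families n M \<equiv> path_families M (\<lambda>_ _. True) (2 * n) (\<lambda>j. int n + int j)"

text \<open>Vertical edges met by a path are sides of tiles; each remaining vertical edge between
  the two extreme columns is the short diagonal of a rhombus, which gives the pairs
  \<open>((t, y), (t, y))\<close>.\<close>

definition matching_of :: "nat \<Rightarrow> nat \<Rightarrow> (nat \<Rightarrow> nat \<Rightarrow> int) \<Rightarrow> ((nat \<times> int) \<times> (nat \<times> int)) set" where
  "matching_of n M P = {((t, P t j), (Suc t, P (Suc t) j)) | t j. t < 2 * n \<and> j < M}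
     \<union> {((t, y), (t, y)) | t y. (t, y) \<in> sites n M \<and> 0 < t \<and> t < 2 * n \<and> y \<notin> P t ` {..<M}}"

lemma full_familiesD:
  assumes "P \<in> full_families n M"
  shows "j < M \<Longrightarrow> P 0 j = int j"
    and "s < 2 * n \<Longrightarrow> j < M \<Longrightarrow> P (Suc s) j = P s j \<or> P (Suc s) j = P s j + 1"
    and "s \<le> 2 * n \<Longrightarrow> i < j \<Longrightarrow> j < M \<Longrightarrow> P s i < P s j"
    and "j < M \<Longrightarrow> P (2 * n) j = int n + int j"
    and "P \<in> {..2 * n} \<rightarrow>\<^sub>E ({..<M} \<rightarrow>\<^sub>E UNIV)"
  using assms by (auto simp: path_families_def increasing_def)

lemma full_families_inj:
  assumes "P \<in> full_families n M" "s \<le> 2 * n" "i < M" "j < M" "P s i = P s j"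
  shows "i = j"
  using full_familiesD(3)[OF assms(1,2), of i j] full_familiesD(3)[OF assms(1,2), of j i] assms(3-)
  by (cases i j rule: linorder_cases) auto

lemma full_families_sites:
  assumes P: "P \<in> full_families n M" and "t \<le> 2 * n" "j < M"
  shows "(t, P t j) \<in> sites n M"
proof -
  have 1: "int j \<le> P t j \<and> P t j \<le> int j + int t"
    using \<open>t \<le> 2 * n\<close>
  proof (induction t)
    case (Suc t)
    then show ?case using full_familiesD(2)[OF P, of t j] assms by auto
  qed (use full_familiesD(1)[OF P] assms in auto)
  \<comment> \<open>Walking back from the prescribed end gives the two bounds of
    \<open>sites\<close> that bind in the right half; \<open>1\<close> gives the other two.\<close>
  have "int n + int j - int s \<le> P (2 * n - s) j \<and> P (2 * n - s) j \<le> int n + int j" if "s \<le> 2 * n" for s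
    using that
  proof (induction s)
    case (Suc s)
    moreover have "Suc (2 * n - Suc s) = 2 * n - s" using Suc.prems by simp
    ultimately show ?case using full_familiesD(2)[OF P, of "2 * n - Suc s" j] assms by auto
  qed (use full_familiesD(4)[OF P] assms in auto)
  from this[of "2 * n - t"] have "int j + int t - int n \<le> P t j \<and> P t j \<le> int n + int j"
    using assms by (simp add: of_nat_diff)
  with 1 show ?thesis using assms by (auto simp: sites_def)
qed

text \<open>In an extreme column an edge has a triangle on one side only and cannot be a diagonal,
  so every such edge has to lie on a path.\<close>

lemma full_families_first:
  assumes P: "P \<in> full_families n M" and "(0, y) \<in> sites n M"
  shows "y \<in> P 0 ` {..<M}"
proof -
  have "nat y < M" "P 0 (nat y) = y"
    using assms full_familiesD(1)[OF P, of "nat y"] by (auto simp: sites_def)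
  then show ?thesis by force
qed

lemma full_families_last:
  assumes P: "P \<in> full_families n M" and "(2 * n, y) \<in> sites n M"
  shows "y \<in> P (2 * n) ` {..<M}"
proof -
  have "nat (y - int n) < M" "P (2 * n) (nat (y - int n)) = y"
    using assms full_familiesD(4)[OF P, of "nat (y - int n)"] by (auto simp: sites_def)
  then show ?thesis by force
qed

lemma matching_of_in_matchings:
  assumes P: "P \<in> full_families n M"
  shows "matching_of n M P \<in> matchings n M"
  unfolding matchings_def
proof (intro CollectI conjI ballI impI)
  show "matching_of n M P \<subseteq> site_pairs n M"
    using full_families_sites[OF P] full_familiesD(2)[OF P]
    by (fastforce simp: matching_of_def site_pairs_def adjacent_def)
next
  fix u assume u: "u \<in> sites n M" "fst u < 2 * n"
  obtain t y where ty: "u = (t, y)" by force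
  show "\<exists>!d. (u, d) \<in> matching_of n M P"
  proof (cases "y \<in> P t ` {..<M}")
    case True
    then obtain j where j: "j < M" "y = P t j" by auto
    show ?thesis
    proof (rule ex1I[of _ "(Suc t, P (Suc t) j)"])
      show "(u, Suc t, P (Suc t) j) \<in> matching_of n M P"
        using j u ty by (auto simp: matching_of_def)
      fix d assume "(u, d) \<in> matching_of n M P"
      then obtain i where "i < M" "P t j = P t i" "d = (Suc t, P (Suc t) i)"
        using True j ty by (auto simp: matching_of_def)
      then show "d = (Suc t, P (Suc t) j)"
        using full_families_inj[OF P, of t j i] j u ty by auto
    qed
  next
    case False
    have "t \<noteq> 0"
    proof
      assume "t = 0"
      then show False using False full_families_first[OF P, of y] u ty by simp
    qed
    show ?thesis
    proof (rule ex1I[of _ u])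
      show "(u, u) \<in> matching_of n M P"
        using False u ty \<open>t \<noteq> 0\<close> by (auto simp: matching_of_def)
      show "d = u" if "(u, d) \<in> matching_of n M P" for d
        using that False ty by (auto simp: matching_of_def)
    qed
  qed
next
  fix d assume d: "d \<in> sites n M" "0 < fst d"
  obtain t y where ty: "d = (t, y)" by force
  obtain s where s: "t = Suc s" using d ty by (cases t) auto
  have le: "t \<le> 2 * n" using d ty by (auto simp: sites_def)
  show "\<exists>!u. (u, d) \<in> matching_of n M P"
  proof (cases "y \<in> P t ` {..<M}")
    case True
    then obtain j where j: "j < M" "y = P t j" by auto
    show ?thesis
    proof (rule ex1I[of _ "(s, P s j)"])
      show "((s, P s j), d) \<in> matching_of n M P"
        using j le s ty by (auto simp: matching_of_def)
      fix u assume "(u, d) \<in> matching_of n M P"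
      then obtain i where "i < M" "P t j = P t i" "u = (s, P s i)"
        using True j ty s by (auto simp: matching_of_def)
      then show "u = (s, P s j)"
        using full_families_inj[OF P le, of j i] j by auto
    qed
  next
    case False
    have "t \<noteq> 2 * n" using False full_families_last[OF P] d ty by auto
    show ?thesis
    proof (rule ex1I[of _ d])
      show "(d, d) \<in> matching_of n M P"
        using False d ty le \<open>t \<noteq> 2 * n\<close> by (auto simp: matching_of_def)
      show "u = d" if "(u, d) \<in> matching_of n M P" for u
        using that False ty by (auto simp: matching_of_def)
    qed
  qed
qed

text \<open>The paths can be read off column by column, since every right triangle has a unique
  partner.\<close>

lemma inj_on_matching_of: "inj_on (matching_of n M) (full_families n M)"
proof (rule inj_onI)
  fix P Q assume P: "P \<in> full_families n M" and Q: "Q \<in> full_families n M"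
    and eq: "matching_of n M P = matching_of n M Q"
  have PQ: "P t j = Q t j" if "t \<le> 2 * n" "j < M" for t j
    using that
  proof (induction t)
    case 0
    then show ?case using full_familiesD(1)[OF P] full_familiesD(1)[OF Q] by simp
  next
    case (Suc t)
    have "((t, P t j), (Suc t, P (Suc t) j)) \<in> matching_of n M P"
      using Suc.prems by (auto simp: matching_of_def)
    moreover have "((t, P t j), (Suc t, Q (Suc t) j)) \<in> matching_of n M P"
      using Suc unfolding eq by (auto simp: matching_of_def)
    moreover have "\<exists>!d. ((t, P t j), d) \<in> matching_of n M P"
      using matching_of_in_matchings[OF P] full_families_sites[OF P, of t j] Suc.prems by (auto simp: matchings_def)
    ultimately show ?case by auto
  qed
  show "P = Q"
  proof (rule PiE_ext[OF full_familiesD(5)[OF P] full_familiesD(5)[OF Q]])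
    fix t assume t: "t \<in> {..2 * n}"
    then have "P t \<in> {..<M} \<rightarrow>\<^sub>E UNIV" "Q t \<in> {..<M} \<rightarrow>\<^sub>E UNIV"
      using full_familiesD(5)[OF P] full_familiesD(5)[OF Q] by (auto simp only: PiE_mem)
    then show "P t = Q t" by (rule PiE_ext) (use PQ t in auto)
  qed
qed

text \<open>The paths are recovered by following partners from the left side. The invariant is that
  in each column the edges not matched to themselves are exactly those reached by the paths.\<close>

lemma matchings_subset_image:
  assumes \<mu>: "\<mu> \<in> matchings n M"
  shows "\<mu> \<in> matching_of n M ` full_families n M"
proof -
  have sub: "\<mu> \<subseteq> site_pairs n M"
    and exu: "\<And>u. u \<in> sites n M \<Longrightarrow> fst u < 2 * n \<Longrightarrow> \<exists>!d. (u, d) \<in> \<mu>"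
    and exd: "\<And>d. d \<in> sites n M \<Longrightarrow> 0 < fst d \<Longrightarrow> \<exists>!u. (u, d) \<in> \<mu>"
    using \<mu> by (auto simp: matchings_def)
  have uniq_d: "d = d'" if "(u, d) \<in> \<mu>" "(u, d') \<in> \<mu>" for u d d'
    using that sub exu[of u] by (auto simp: site_pairs_def)
  have uniq_u: "u = u'" if "(u, d) \<in> \<mu>" "(u', d) \<in> \<mu>" for u u' d
  proof -
    have "d \<in> sites n M" "0 < fst d" using that sub by (auto simp: site_pairs_def)
    then show ?thesis using exd[of d] that by blast
  qed
  \<comment> \<open>Where no partner lies in the next column, \<open>SOME\<close> yields an
    arbitrary height. \<open>step\<close> uses the value only when the current edge is not matched
    to itself, and then such a partner exists.\<close>
  define R where "R = rec_nat int (\<lambda>t p j. SOME y. ((t, p j), (Suc t, y)) \<in> \<mu>)"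
  have R0: "R 0 j = int j" for j by (simp add: R_def)
  have RS: "R (Suc t) j = (SOME y. ((t, R t j), (Suc t, y)) \<in> \<mu>)" for t j by (simp add: R_def)
  have step: "((t, R t j), (Suc t, R (Suc t) j)) \<in> \<mu>"
    if "(t, R t j) \<in> sites n M" "t < 2 * n" "((t, R t j), (t, R t j)) \<notin> \<mu>" for t j
  proof -
    have "\<exists>!d. ((t, R t j), d) \<in> \<mu>" using exu[of "(t, R t j)"] that by simp
    then obtain d where d: "((t, R t j), d) \<in> \<mu>" by blast
    then have "adjacent (t, R t j) d" using sub by (auto simp: site_pairs_def)
    then have "d = (Suc t, snd d)" using d that by (cases d) (auto simp: adjacent_def)
    then have "\<exists>y. ((t, R t j), (Suc t, y)) \<in> \<mu>" using d by metis
    then show ?thesis unfolding RS by (rule someI_ex)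
  qed
  have inv: "(\<forall>j<M. (t, R t j) \<in> sites n M) \<and> increasing M (R t) \<and>
      {y. (t, y) \<in> sites n M \<and> ((t, y), (t, y)) \<notin> \<mu>} = R t ` {..<M}" if "t \<le> 2 * n" for t
    using that
  proof (induction t)
    case 0
    have s0: "(0, y) \<in> sites n M \<longleftrightarrow> 0 \<le> y \<and> y < int M" for y by (auto simp: sites_def)
    have "((0, y), (0, y)) \<notin> \<mu>" for y using sub by (auto simp: site_pairs_def)
    moreover have "{y. 0 \<le> y \<and> y < int M} = int ` {..<M}"
      by (auto simp: image_iff intro!: bexI[of _ "nat _"])
    ultimately show ?case by (auto simp: s0 R0 increasing_def)
  next
    case (Suc t)
    then have t: "t < 2 * n" and IH1: "\<And>j. j < M \<Longrightarrow> (t, R t j) \<in> sites n M" and IH2: "increasing M (R t)"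
      and IH3: "{y. (t, y) \<in> sites n M \<and> ((t, y), (t, y)) \<notin> \<mu>} = R t ` {..<M}" by auto
    have nh: "((t, R t j), (t, R t j)) \<notin> \<mu>" if "j < M" for j using IH3 that by blast
    have st: "((t, R t j), (Suc t, R (Suc t) j)) \<in> \<mu>" if "j < M" for j
      using step[of t j] IH1 nh t that by auto
    have in_s: "(Suc t, R (Suc t) j) \<in> sites n M" and move: "R (Suc t) j = R t j \<or> R (Suc t) j = R t j + 1" if "j < M" for j
      using st[OF that] sub by (auto simp: site_pairs_def adjacent_def)
    have "R (Suc t) i < R (Suc t) j" if ij: "i < j" "j < M" for i j
    proof -
      have lt: "R t i < R t j" using IH2 ij by (auto simp: increasing_def)
      \<comment> \<open>With steps 0 or 1, paths in strict order would have to meet before crossing,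
        and a meeting point would be a left triangle with two partners.\<close>
      moreover have "R (Suc t) i \<noteq> R (Suc t) j"
      proof
        assume "R (Suc t) i = R (Suc t) j"
        then have "(t, R t i) = (t, R t j)"
          using st[of i] st[of j] ij uniq_u[of "(t, R t i)" _ "(t, R t j)"] by auto
        then show False using lt by simp
      qed
      ultimately show ?thesis using move[of i] move[of j] ij by auto
    qed
    then have inc: "increasing M (R (Suc t))" by (auto simp: increasing_def)
    have "{y. (Suc t, y) \<in> sites n M \<and> ((Suc t, y), (Suc t, y)) \<notin> \<mu>} = R (Suc t) ` {..<M}"
    proof (intro equalityI subsetI)
      fix y assume "y \<in> {y. (Suc t, y) \<in> sites n M \<and> ((Suc t, y), (Suc t, y)) \<notin> \<mu>}"
      then have y: "(Suc t, y) \<in> sites n M" "((Suc t, y), (Suc t, y)) \<notin> \<mu>" by auto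
      then have "\<exists>!u. (u, (Suc t, y)) \<in> \<mu>" using exd[of "(Suc t, y)"] by simp
      then obtain u where u: "(u, (Suc t, y)) \<in> \<mu>" by blast
      obtain x where x: "u = (t, x)" "u \<in> sites n M"
        using u y sub by (cases u) (auto simp: site_pairs_def adjacent_def)
      have "((t, x), (t, x)) \<notin> \<mu>" using uniq_d[of u "(Suc t, y)" "(t, x)"] u x by auto
      then obtain j where j: "j < M" "x = R t j" using IH3 x by blast
      then have "y = R (Suc t) j" using uniq_d[of u "(Suc t, y)"] u st[of j] x by auto
      then show "y \<in> R (Suc t) ` {..<M}" using j by auto
    next
      fix y assume "y \<in> R (Suc t) ` {..<M}"
      then obtain j where j: "j < M" "y = R (Suc t) j" by auto
      have "((Suc t, y), (Suc t, y)) \<notin> \<mu>" using uniq_u[of "(Suc t, y)" "(Suc t, y)"] st[of j] j by force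
      then show "y \<in> {y. (Suc t, y) \<in> sites n M \<and> ((Suc t, y), (Suc t, y)) \<notin> \<mu>}"
        using j in_s by auto
    qed
    then show ?case using in_s inc by blast
  qed
  \<comment> \<open>Column \<open>2 * n\<close> contains only \<open>M\<close> edges, so the order
    of the paths determines where they end.\<close>
  have last: "R (2 * n) j = int n + int j" if "j < M" for j
  proof (rule increasing_in_interval[OF _ _ that])
    show "increasing M (R (2 * n))" using inv[of "2 * n"] by simp
    show "int n \<le> R (2 * n) j \<and> R (2 * n) j < int n + int M" if "j < M" for j
      using inv[of "2 * n"] that by (auto simp: sites_def)
  qed
  have st: "((t, R t j), (Suc t, R (Suc t) j)) \<in> \<mu>" if "t < 2 * n" "j < M" for t j
    using inv[of t] step[of t j] that by auto
  define P where "P = (\<lambda>t\<in>{..2 * n}. \<lambda>j\<in>{..<M}. R t j)"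
  have PR: "P t j = R t j" if "t \<le> 2 * n" "j < M" for t j using that by (simp add: P_def)
  have img: "P t ` {..<M} = R t ` {..<M}" if "t \<le> 2 * n" for t using that PR by (intro image_cong) auto
  have "P \<in> full_families n M"
    unfolding path_families_def
  proof (intro CollectI conjI allI impI)
    show "P \<in> {..2 * n} \<rightarrow>\<^sub>E {..<M} \<rightarrow>\<^sub>E UNIV" by (auto simp: P_def)
    show "P 0 j = int j" if "j < M" for j using that by (simp add: PR R0)
    show "P (Suc s) j = P s j \<or> P (Suc s) j = P s j + 1" if "s < 2 * n" "j < M" for s j
      using st[OF that] sub that by (auto simp: site_pairs_def adjacent_def PR)
    show "increasing M (P s)" if "s \<le> 2 * n" for s
      using inv[OF that] that by (auto simp: increasing_def PR)
    show "P (2 * n) j = int n + int j" if "j < M" for j using last that by (simp add: PR)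
  qed auto
  moreover have "\<mu> = matching_of n M P"
  proof (intro equalityI subsetI)
    fix z assume z: "z \<in> \<mu>"
    obtain t y d where zd: "z = ((t, y), d)" by (metis surj_pair)
    have ty: "(t, y) \<in> sites n M" "t < 2 * n" "d \<in> sites n M" "0 < fst d" "adjacent (t, y) d"
      using z sub by (auto simp: zd site_pairs_def)
    show "z \<in> matching_of n M P"
    proof (cases "d = (t, y)")
      case True
      then have "y \<notin> R t ` {..<M}" using inv[of t] z ty zd by auto
      then show ?thesis using True ty zd img[of t] by (auto simp: matching_of_def)
    next
      case False
      then have "((t, y), (t, y)) \<notin> \<mu>" using uniq_d[of "(t, y)" d "(t, y)"] z zd by auto
      then have "y \<in> R t ` {..<M}" using inv[of t] ty by auto
      then obtain j where j: "j < M" "y = R t j" by auto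
      then have "d = (Suc t, R (Suc t) j)" using uniq_d[of "(t, y)" d] z zd st[of t j] ty by auto
      then show ?thesis using j zd ty by (auto simp: matching_of_def PR intro!: exI[of _ t] exI[of _ j])
    qed
  next
    fix z assume "z \<in> matching_of n M P"
    then consider t j where "t < 2 * n" "j < M" "z = ((t, P t j), (Suc t, P (Suc t) j))"
      | t y where "(t, y) \<in> sites n M" "0 < t" "t < 2 * n" "y \<notin> P t ` {..<M}" "z = ((t, y), (t, y))"
      unfolding matching_of_def by blast
    then show "z \<in> \<mu>"
    proof cases
      case (1 t j)
      then show ?thesis using st[of t j] by (simp add: PR)
    next
      case (2 t y)
      then show ?thesis using inv[of t] img[of t] by auto
    qed
  qed
  ultimately show ?thesis by blast
qed

text \<open>A pair \<open>((t, c), (t, c))\<close> occurs exactly when no path passes through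
  \<open>c\<close> in column \<open>t\<close>, so a required rhombus becomes a forbidden
  height.\<close>

lemma card_matchings_with_hole:
  assumes "(t, c) \<in> sites n M" "0 < t" "t < 2 * n"
  shows "card {\<mu> \<in> matchings n M. ((t, c), (t, c)) \<in> \<mu>}
    = card (path_families M (\<lambda>s x. \<not> (s = t \<and> x = c)) (2 * n) (\<lambda>j. int n + int j))"
proof -
  let ?F = "path_families M (\<lambda>s x. \<not> (s = t \<and> x = c)) (2 * n) (\<lambda>j. int n + int j)"
  have F: "?F = {P \<in> full_families n M. c \<notin> P t ` {..<M}}"
  proof -
    have "(\<forall>s\<le>2 * n. \<forall>j<M. \<not> (s = t \<and> P s j = c)) \<longleftrightarrow> c \<notin> P t ` {..<M}" for P :: "nat \<Rightarrow> nat \<Rightarrow> int"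
    proof (intro iffI notI)
      assume H: "\<forall>s\<le>2 * n. \<forall>j<M. \<not> (s = t \<and> P s j = c)" and "c \<in> P t ` {..<M}"
      then obtain j where "j < M" "P t j = c" by blast
      moreover have "t \<le> 2 * n" using assms by simp
      ultimately show False using H by simp
    qed blast
    then have "P \<in> ?F \<longleftrightarrow> P \<in> full_families n M \<and> c \<notin> P t ` {..<M}" for P
      by (simp only: path_families_def mem_Collect_eq simp_thms conj_ac)
    then show ?thesis by blast
  qed
  have iff: "((t, c), (t, c)) \<in> matching_of n M P \<longleftrightarrow> c \<notin> P t ` {..<M}" for P
    using assms by (auto simp: matching_of_def)
  have "{\<mu> \<in> matchings n M. ((t, c), (t, c)) \<in> \<mu>} = matching_of n M ` ?F"
  proof (intro equalityI subsetI)
    fix \<mu> assume \<mu>: "\<mu> \<in> {\<mu> \<in> matchings n M. ((t, c), (t, c)) \<in> \<mu>}"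
    then obtain P where "P \<in> full_families n M" "\<mu> = matching_of n M P"
      using matchings_subset_image[of \<mu> n M] by blast
    then show "\<mu> \<in> matching_of n M ` ?F" using \<mu> iff[of P] unfolding F by blast
  next
    fix \<mu> assume "\<mu> \<in> matching_of n M ` ?F"
    then obtain P where "P \<in> full_families n M" "c \<notin> P t ` {..<M}" "\<mu> = matching_of n M P"
      unfolding F by blast
    then show "\<mu> \<in> {\<mu> \<in> matchings n M. ((t, c), (t, c)) \<in> \<mu>}"
      using iff[of P] matching_of_in_matchings[of P M n] by blast
  qed
  moreover have "inj_on (matching_of n M) ?F"
    unfolding F by (rule inj_on_subset[OF inj_on_matching_of]) blast
  ultimately show ?thesis by (simp add: card_image)
qed

section \<open>Geometry of the triangular lattice\<close>

text \<open>Lattice coordinates: \<open>ci M p\<close> and \<open>cj p\<close> are the coefficients of \<open>p - (0, M/2)\<close> in the basis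
  \<open>(0, 1)\<close>, \<open>(sqrt 3 / 2, 1 / 2)\<close>.\<close>

definition pt :: "nat \<Rightarrow> real \<Rightarrow> real \<Rightarrow> real \<times> real" where
  "pt M x y = (sqrt 3 / 2 * y, real M / 2 + x + y / 2)"

definition ci :: "nat \<Rightarrow> real \<times> real \<Rightarrow> real" where
  "ci M p = snd p - real M / 2 - fst p / sqrt 3"

definition cj :: "real \<times> real \<Rightarrow> real" where
  "cj p = 2 * fst p / sqrt 3"

lemma ci_pt [simp]: "ci M (pt M x y) = x"
  by (simp add: ci_def pt_def)

lemma cj_pt [simp]: "cj (pt M x y) = y"
  by (simp add: cj_def pt_def)

lemma pt_ci_cj [simp]: "pt M (ci M p) (cj p) = p"
  by (cases p) (simp add: pt_def ci_def cj_def)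

lemma pt_eq_iff [simp]: "pt M x y = pt M x' y' \<longleftrightarrow> x = x' \<and> y = y'"
  by (metis ci_pt cj_pt)

lemma ci_convex: "u + v = 1 \<Longrightarrow> ci M (u *\<^sub>R p + v *\<^sub>R q) = u * ci M p + v * ci M q"
proof -
  assume "u + v = 1"
  then have "v = 1 - u" by simp
  show ?thesis unfolding \<open>v = 1 - u\<close>
    by (simp add: ci_def algebra_simps add_divide_distrib diff_divide_distrib)
qed

lemma cj_convex: "cj (u *\<^sub>R p + v *\<^sub>R q) = u * cj p + v * cj q"
  by (simp add: cj_def algebra_simps add_divide_distrib)

lemma convex_ci_cj_le: "convex {p. \<alpha> * ci M p + \<beta> * cj p \<le> c}"
proof (rule convexI)
  fix p q and u v :: real
  assume "p \<in> {p. \<alpha> * ci M p + \<beta> * cj p \<le> c}" "q \<in> {p. \<alpha> * ci M p + \<beta> * cj p \<le> c}" and uv: "0 \<le> u" "0 \<le> v" "u + v = 1"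
  then have "u * (\<alpha> * ci M p + \<beta> * cj p) + v * (\<alpha> * ci M q + \<beta> * cj q) \<le> u * c + v * c"
    by (intro add_mono mult_left_mono) auto
  also have "u * c + v * c = c" using uv by (metis distrib_right mult_1)
  finally show "u *\<^sub>R p + v *\<^sub>R q \<in> {p. \<alpha> * ci M p + \<beta> * cj p \<le> c}"
    using uv by (simp add: ci_convex cj_convex algebra_simps)
qed

lemma pt_convex_comb:
  assumes "convex S" "pt M x y \<in> S" "pt M x' y' \<in> S" "0 \<le> u" "u \<le> 1"
  shows "pt M ((1 - u) * x + u * x') ((1 - u) * y + u * y') \<in> S"
proof -
  have "(1 - u) *\<^sub>R pt M x y + u *\<^sub>R pt M x' y' \<in> S"
    using assms by (intro convexD) auto
  also have "(1 - u) *\<^sub>R pt M x y + u *\<^sub>R pt M x' y' = pt M ((1 - u) * x + u * x') ((1 - u) * y + u * y')"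
    by (simp add: pt_def) (simp add: field_simps)
  finally show ?thesis .
qed

text \<open>In lattice coordinates each side becomes one inequality with coefficients 0 or 1 up to
  sign, so that containment of lattice triangles is integer arithmetic.\<close>

lemma hexagon_eq:
  assumes "n \<ge> 1" "M \<ge> 1"
  shows "hexagon n M = {p. 0 \<le> cj p \<and> cj p \<le> 2 * real n \<and> - real M - real n \<le> ci M p \<and> ci M p \<le> 0 \<and>
     - real M \<le> ci M p + cj p \<and> ci M p + cj p \<le> real n}" (is "_ = ?H")
proof -
  let ?V = "{pt M 0 0, pt M (- real M) 0, pt M 0 (real n), pt M (- real M - real n) (real n),
      pt M (- real n) (2 * real n), pt M (- real M - real n) (2 * real n)}"
  have V: "hexagon n M = convex hull ?V"
    unfolding hexagon_def pt_def by (rule arg_cong[where f = "\<lambda>S. convex hull S"]) (simp add: field_simps insert_commute)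
  have "?H = {p. 0 * ci M p + (-1) * cj p \<le> 0} \<inter> {p. 0 * ci M p + 1 * cj p \<le> 2 * real n}
     \<inter> {p. (-1) * ci M p + 0 * cj p \<le> real M + real n} \<inter> {p. 1 * ci M p + 0 * cj p \<le> 0}
     \<inter> {p. (-1) * ci M p + (-1) * cj p \<le> real M} \<inter> {p. 1 * ci M p + 1 * cj p \<le> real n}"
    by auto
  then have conv: "convex ?H"
    by (simp only:) (intro convex_Int convex_ci_cj_le)
  have sub: "convex hull ?V \<subseteq> ?H"
    using conv by (intro hull_minimal) auto
  have "?H \<subseteq> convex hull ?V"
  proof
    fix p assume p: "p \<in> ?H"
    define x y where "x = ci M p" and "y = cj p"
    have pxy: "p = pt M x y" by (simp add: x_def y_def)
    have xy: "0 \<le> y" "y \<le> 2 * real n" "- real M - real n \<le> x" "x \<le> 0" "- real M \<le> x + y" "x + y \<le> real n"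
      using p by (auto simp: x_def y_def)
    let ?S = "convex hull ?V"
    have S: "convex ?S" by (rule convex_convex_hull)
    have V: "v \<in> ?S" if "v \<in> ?V" for v using that by (rule hull_inc)
    have n0: "real n > 0" "real M > 0" using assms by auto
    \<comment> \<open>Each point is on a vertical segment between an upper and a lower boundary
      point. The sides carrying these two points change at \<open>y = n\<close>, hence the case
      split below.\<close>
    have vert: "pt M x y \<in> ?S" if "pt M a y \<in> ?S" "pt M b y \<in> ?S" "a < b" "a \<le> x" "x \<le> b" for a b
    proof -
      define u where "u = (x - a) / (b - a)"
      have "u * (b - a) = x - a" using that by (simp add: u_def)
      then have "(1 - u) * a + u * b = x" "(1 - u) * y + u * y = y" by (simp_all add: algebra_simps)
      moreover have "0 \<le> u" "u \<le> 1" using that by (auto simp: u_def field_simps)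
      ultimately show ?thesis using pt_convex_comb[OF S that(1,2), of u] by simp
    qed
    show "p \<in> ?S"
    proof (cases "y \<le> real n")
      case True
      define u where "u = y / real n"
      have u: "0 \<le> u" "u \<le> 1" "u * real n = y" using True xy n0 by (auto simp: u_def)
      have "pt M ((1 - u) * 0 + u * 0) ((1 - u) * 0 + u * real n) \<in> ?S"
        by (rule pt_convex_comb[OF S V V u(1,2)]) auto
      moreover have "pt M ((1 - u) * (- real M) + u * (- real M - real n)) ((1 - u) * 0 + u * real n) \<in> ?S"
        by (rule pt_convex_comb[OF S V V u(1,2)]) auto
      moreover have "(1 - u) * (- real M) + u * (- real M - real n) = - real M - y"
        using u(3) by (simp add: algebra_simps)
      ultimately have "pt M 0 y \<in> ?S" "pt M (- real M - y) y \<in> ?S" using u(3) by auto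
      then show ?thesis unfolding pxy using xy n0 by (intro vert[of "- real M - y" 0]) auto
    next
      case False
      define u where "u = (y - real n) / real n"
      have u: "0 \<le> u" "u \<le> 1" "u * real n = y - real n" using False xy n0 by (auto simp: u_def field_simps)
      have "pt M ((1 - u) * 0 + u * (- real n)) ((1 - u) * real n + u * (2 * real n)) \<in> ?S"
        by (rule pt_convex_comb[OF S V V u(1,2)]) auto
      moreover have "pt M ((1 - u) * (- real M - real n) + u * (- real M - real n)) ((1 - u) * real n + u * (2 * real n)) \<in> ?S"
        by (rule pt_convex_comb[OF S V V u(1,2)]) auto
      moreover have "(1 - u) * (- real M - real n) + u * (- real M - real n) = - real M - real n"
         "(1 - u) * real n + u * (2 * real n) = y" "(1 - u) * 0 + u * (- real n) = real n - y"
        using u(3) by (simp_all add: algebra_simps)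
      ultimately have "pt M (real n - y) y \<in> ?S" "pt M (- real M - real n) y \<in> ?S" by (simp_all only:)
      then show ?thesis unfolding pxy using xy n0 by (intro vert[of "- real M - real n" "real n - y"]) auto
    qed
  qed
  then show ?thesis unfolding V using sub by blast
qed

text \<open>The two kinds of unit triangles: \<open>up_tri\<close> points to the right, \<open>down_tri\<close> to the left.\<close>

definition up_tri :: "nat \<Rightarrow> int \<Rightarrow> int \<Rightarrow> (real \<times> real) set" where
  "up_tri M a b = {p. of_int a \<le> ci M p \<and> of_int b \<le> cj p \<and> ci M p + cj p \<le> of_int a + of_int b + 1}"

definition down_tri :: "nat \<Rightarrow> int \<Rightarrow> int \<Rightarrow> (real \<times> real) set" where
  "down_tri M a b = {p. ci M p \<le> of_int a + 1 \<and> cj p \<le> of_int b + 1 \<and> of_int a + of_int b + 1 \<le> ci M p + cj p}"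

definition lp :: "nat \<Rightarrow> int \<Rightarrow> int \<Rightarrow> real \<times> real" where
  "lp M a b = pt M (of_int a) (of_int b)"

lemma ci_lp [simp]: "ci M (lp M a b) = of_int a"
  by (simp add: lp_def)

lemma cj_lp [simp]: "cj (lp M a b) = of_int b"
  by (simp add: lp_def)

lemma lp_eq_iff [simp]: "lp M a b = lp M a' b' \<longleftrightarrow> a = a' \<and> b = b'"
  by (simp add: lp_def)

lemma pt_comb3:
  assumes "u + v + w = 1"
  shows "u *\<^sub>R pt M x y + v *\<^sub>R pt M x' y' + w *\<^sub>R pt M x'' y''
    = pt M (u * x + v * x' + w * x'') (u * y + v * y' + w * y'')"
proof -
  have "u * real M + v * real M + w * real M = real M"
    using assms by (metis distrib_right mult_1)
  then show ?thesis by (simp add: pt_def) (simp add: field_simps)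
qed

lemma hull_up: "convex hull {lp M a b, lp M (a + 1) b, lp M a (b + 1)} = up_tri M a b"
proof (intro equalityI subsetI)
  fix p assume "p \<in> convex hull {lp M a b, lp M (a + 1) b, lp M a (b + 1)}"
  then obtain u v w where uvw: "0 \<le> u" "0 \<le> v" "0 \<le> w" "u + v + w = 1"
    and p: "p = u *\<^sub>R lp M a b + v *\<^sub>R lp M (a + 1) b + w *\<^sub>R lp M a (b + 1)"
    unfolding convex_hull_3 by blast
  have u: "u = 1 - v - w" using uvw by simp
  show "p \<in> up_tri M a b"
    unfolding p lp_def pt_comb3[OF uvw(4)] up_tri_def using uvw by (simp add: u algebra_simps)
next
  fix p assume p: "p \<in> up_tri M a b"
  \<comment> \<open>Barycentric weights: the slacks in the inequalities that define the
    triangle.\<close>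
  define v w where "v = ci M p - of_int a" and "w = cj p - of_int b"
  have "p = pt M (ci M p) (cj p)" by simp
  also have "\<dots> = (1 - v - w) *\<^sub>R lp M a b + v *\<^sub>R lp M (a + 1) b + w *\<^sub>R lp M a (b + 1)"
    unfolding lp_def by (subst pt_comb3) (simp_all add: v_def w_def algebra_simps)
  finally have "p = (1 - v - w) *\<^sub>R lp M a b + v *\<^sub>R lp M (a + 1) b + w *\<^sub>R lp M a (b + 1)" .
  moreover have "0 \<le> 1 - v - w" "0 \<le> v" "0 \<le> w" using p by (auto simp: up_tri_def v_def w_def)
  moreover have "1 - v - w + v + w = 1" by simp
  ultimately show "p \<in> convex hull {lp M a b, lp M (a + 1) b, lp M a (b + 1)}"
    unfolding convex_hull_3 by blast
qed

lemma hull_down: "convex hull {lp M (a + 1) (b + 1), lp M (a + 1) b, lp M a (b + 1)} = down_tri M a b"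
proof (intro equalityI subsetI)
  fix p assume "p \<in> convex hull {lp M (a + 1) (b + 1), lp M (a + 1) b, lp M a (b + 1)}"
  then obtain u v w where uvw: "0 \<le> u" "0 \<le> v" "0 \<le> w" "u + v + w = 1"
    and p: "p = u *\<^sub>R lp M (a + 1) (b + 1) + v *\<^sub>R lp M (a + 1) b + w *\<^sub>R lp M a (b + 1)"
    unfolding convex_hull_3 by blast
  have u: "u = 1 - v - w" using uvw by simp
  show "p \<in> down_tri M a b"
    unfolding p lp_def pt_comb3[OF uvw(4)] down_tri_def using uvw by (simp add: u algebra_simps)
next
  fix p assume p: "p \<in> down_tri M a b"
  define v w where "v = of_int b + 1 - cj p" and "w = of_int a + 1 - ci M p"
  have "p = pt M (ci M p) (cj p)" by simp
  also have "\<dots> = (1 - v - w) *\<^sub>R lp M (a + 1) (b + 1) + v *\<^sub>R lp M (a + 1) b + w *\<^sub>R lp M a (b + 1)"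
    unfolding lp_def by (subst pt_comb3) (simp_all add: v_def w_def algebra_simps)
  finally have "p = (1 - v - w) *\<^sub>R lp M (a + 1) (b + 1) + v *\<^sub>R lp M (a + 1) b + w *\<^sub>R lp M a (b + 1)" .
  moreover have "0 \<le> 1 - v - w" "0 \<le> v" "0 \<le> w" using p by (auto simp: down_tri_def v_def w_def)
  moreover have "1 - v - w + v + w = 1" by simp
  ultimately show "p \<in> convex hull {lp M (a + 1) (b + 1), lp M (a + 1) b, lp M a (b + 1)}"
    unfolding convex_hull_3 by blast
qed

section \<open>Unit triangles and rhombi in lattice coordinates\<close>

lemma lattice_points_eq: "lattice_points M = {lp M i j | i j. True}"
  unfolding lattice_points_def lp_def pt_def by (intro Collect_cong ex_cong1) (simp add: field_simps)

definition unit_vector :: "int \<Rightarrow> int \<Rightarrow> bool" where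
  "unit_vector x y \<longleftrightarrow> (x, y) \<in> {(1, 0), (0, 1), (-1, 1), (-1, 0), (0, -1), (1, -1)}"

text \<open>The quadratic form is the squared Euclidean length. Completing the square, four times
  the form is \<open>3 * z\<^sup>2 + (z + 2 * w)\<^sup>2\<close>, which bounds each coordinate by 1
  and leaves finitely many cases.\<close>

lemma unit_vector_iff: "unit_vector x y \<longleftrightarrow> x\<^sup>2 + x * y + y\<^sup>2 = 1"
proof
  assume eq: "x\<^sup>2 + x * y + y\<^sup>2 = 1"
  have bound: "\<bar>z\<bar> \<le> 1" if "z\<^sup>2 + z * w + w\<^sup>2 = 1" for z w :: int
  proof (rule ccontr)
    assume "\<not> \<bar>z\<bar> \<le> 1"
    then have "2\<^sup>2 \<le> \<bar>z\<bar>\<^sup>2" by (intro power_mono) auto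
    moreover have "3 * z\<^sup>2 + (z + 2 * w)\<^sup>2 = 4 * (z\<^sup>2 + z * w + w\<^sup>2)" by (simp add: power2_eq_square algebra_simps)
    then have "3 * z\<^sup>2 + (z + 2 * w)\<^sup>2 = 4" using that by simp
    moreover have "(z + 2 * w)\<^sup>2 \<ge> 0" by simp
    ultimately show False by simp
  qed
  have "\<bar>x\<bar> \<le> 1" "\<bar>y\<bar> \<le> 1" using bound[of x y] bound[of y x] eq by (auto simp: algebra_simps)
  then have "x = -1 \<or> x = 0 \<or> x = 1" "y = -1 \<or> y = 0 \<or> y = 1" by auto
  then show "unit_vector x y" using eq by (auto simp: unit_vector_def)
qed (auto simp: unit_vector_def)

lemma dist_lp: "dist (lp M a b) (lp M a' b') = 1 \<longleftrightarrow> unit_vector (a' - a) (b' - b)"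
proof -
  have "dist (lp M a b) (lp M a' b') = sqrt ((sqrt 3 / 2 * (of_int b - of_int b'))\<^sup>2 + ((of_int a - of_int a') + (of_int b - of_int b') / 2)\<^sup>2)"
    by (simp add: lp_def pt_def dist_Pair_Pair dist_real_def) (simp add: algebra_simps diff_divide_distrib)
  also have "(sqrt 3 / 2 * (of_int b - of_int b'))\<^sup>2 + ((of_int a - of_int a') + (of_int b - of_int b') / 2)\<^sup>2
     = of_int ((a' - a)\<^sup>2 + (a' - a) * (b' - b) + (b' - b)\<^sup>2)"
    by (simp add: power_mult_distrib) (simp add: power2_eq_square field_simps)
  finally show ?thesis
    unfolding unit_vector_iff by (simp only: real_sqrt_eq_1_iff of_int_eq_1_iff)
qed

text \<open>The two candidates are the rotations of \<open>x\<close> by 60 degrees, clockwise and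
  counterclockwise: the apexes of the two equilateral triangles over an edge.\<close>

lemma unit_vector_apex:
  assumes "unit_vector x1 x2" "unit_vector y1 y2" "unit_vector (y1 - x1) (y2 - x2)"
  shows "(y1, y2) = (- x2, x1 + x2) \<or> (y1, y2) = (x1 + x2, - x1)"
  using assms by (auto simp: unit_vector_def)

lemma unit_triangle_lp:
  "unit_triangle n M (lp M a b) (lp M c d) (lp M e f) \<longleftrightarrow>
    unit_vector (c - a) (d - b) \<and> unit_vector (e - c) (f - d) \<and> unit_vector (a - e) (b - f) \<and>
    convex hull {lp M a b, lp M c d, lp M e f} \<subseteq> hexagon n M"
  by (auto simp: unit_triangle_def lattice_points_eq dist_lp )

text \<open>Distinct triangles over one edge have the two opposite apexes, and one of them points
  right while the other points left. The three offsets of \<open>(a', b')\<close> are the three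
  edges of the right-pointing triangle.\<close>

lemma rhombi_eq:
  "rhombi n M = {up_tri M a b \<union> down_tri M a' b' | a b a' b'.
     (a', b') \<in> {(a, b), (a - 1, b), (a, b - 1)} \<and> up_tri M a b \<subseteq> hexagon n M \<and> down_tri M a' b' \<subseteq> hexagon n M}"
  (is "_ = ?R")
proof (intro equalityI subsetI)
  fix X assume "X \<in> rhombi n M"
  then obtain p q r s where X: "X = convex hull {p, q, r} \<union> convex hull {s, q, r}"
    and t: "unit_triangle n M p q r" "unit_triangle n M s q r" "p \<noteq> s"
    unfolding rhombi_def by blast
  have "p \<in> lattice_points M" "q \<in> lattice_points M" "r \<in> lattice_points M" "s \<in> lattice_points M"
    using t by (auto simp: unit_triangle_def)
  then obtain p1 p2 q1 q2 r1 r2 s1 s2 where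
    pq: "p = lp M p1 p2" "q = lp M q1 q2" "r = lp M r1 r2" "s = lp M s1 s2"
    unfolding lattice_points_eq mem_Collect_eq by metis
  define x1 x2 where "x1 = r1 - q1" and "x2 = r2 - q2"
  have r: "r1 = q1 + x1" "r2 = q2 + x2" by (simp_all add: x1_def x2_def)
  have neg: "unit_vector (- u) (- v) \<longleftrightarrow> unit_vector u v" for u v by (auto simp: unit_vector_def)
  note T = t(1,2)[unfolded pq unit_triangle_lp]
  have x: "unit_vector x1 x2" using T by (simp add: x1_def x2_def)
  have p': "(p1 - q1, p2 - q2) = (- x2, x1 + x2) \<or> (p1 - q1, p2 - q2) = (x1 + x2, - x1)"
    using T neg[of "p1 - q1" "p2 - q2"] by (intro unit_vector_apex[OF x]) (auto simp: x1_def x2_def)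
  have s': "(s1 - q1, s2 - q2) = (- x2, x1 + x2) \<or> (s1 - q1, s2 - q2) = (x1 + x2, - x1)"
    using T neg[of "s1 - q1" "s2 - q2"] by (intro unit_vector_apex[OF x]) (auto simp: x1_def x2_def)
  have hull: "convex hull {p, q, r} \<subseteq> hexagon n M" "convex hull {s, q, r} \<subseteq> hexagon n M"
    using t by (auto simp: unit_triangle_def)
  \<comment> \<open>\<open>A\<close> and \<open>B\<close> are the triangles over the edge from
    \<open>q\<close> in direction \<open>(x1, x2)\<close>, with the clockwise and the
    counterclockwise apex. Which one is \<open>up_tri\<close> depends on which of the six directions
    occurs.\<close>
  define A where "A = convex hull {lp M (q1 - x2) (q2 + x1 + x2), q, r}"
  define B where "B = convex hull {lp M (q1 + x1 + x2) (q2 - x1), q, r}"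
  have "{p, s} = {lp M (q1 - x2) (q2 + x1 + x2), lp M (q1 + x1 + x2) (q2 - x1)}"
  proof -
    have "p1 = q1 - x2 \<and> p2 = q2 + x1 + x2 \<or> p1 = q1 + x1 + x2 \<and> p2 = q2 - x1"
      "s1 = q1 - x2 \<and> s2 = q2 + x1 + x2 \<or> s1 = q1 + x1 + x2 \<and> s2 = q2 - x1" using p' s' by auto
    then show ?thesis using t(3) unfolding pq by (elim disjE conjE) (simp_all add: insert_commute)
  qed
  then have XAB: "X = A \<union> B" and AB: "A \<subseteq> hexagon n M" "B \<subseteq> hexagon n M"
    using X hull unfolding A_def B_def doubleton_eq_iff by auto
  have "\<exists>a b a' b'. (a', b') \<in> {(a, b), (a - 1, b), (a, b - 1)} \<and>
      (A = up_tri M a b \<and> B = down_tri M a' b' \<or> B = up_tri M a b \<and> A = down_tri M a' b')"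
  proof -
    have up: "convex hull {p, q, r} = up_tri M a b" if "{p, q, r} = {lp M a b, lp M (a + 1) b, lp M a (b + 1)}" for p q r a b
      using that hull_up by simp
    have down: "convex hull {p, q, r} = down_tri M a b" if "{p, q, r} = {lp M (a + 1) (b + 1), lp M (a + 1) b, lp M a (b + 1)}" for p q r a b
      using that hull_down by simp
    consider "x1 = 1" "x2 = 0" | "x1 = 0" "x2 = 1" | "x1 = -1" "x2 = 1" | "x1 = -1" "x2 = 0" | "x1 = 0" "x2 = -1" | "x1 = 1" "x2 = -1"
      using x by (auto simp: unit_vector_def)
    then show ?thesis
    proof cases
      case 1
      have "A = up_tri M q1 q2" unfolding A_def pq r 1 by (rule up) auto
      moreover have "B = down_tri M q1 (q2 - 1)" unfolding B_def pq r 1 by (rule down) auto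
      ultimately show ?thesis by blast
    next
      case 2
      have "B = up_tri M q1 q2" unfolding B_def pq r 2 by (rule up) auto
      moreover have "A = down_tri M (q1 - 1) q2" unfolding A_def pq r 2 by (rule down) auto
      ultimately show ?thesis by blast
    next
      case 3
      have "A = up_tri M (q1 - 1) q2" unfolding A_def pq r 3 by (rule up) auto
      moreover have "B = down_tri M (q1 - 1) q2" unfolding B_def pq r 3 by (rule down) auto
      ultimately show ?thesis by blast
    next
      case 4
      have "B = up_tri M (q1 - 1) q2" unfolding B_def pq r 4 by (rule up) auto
      moreover have "A = down_tri M (q1 - 1) (q2 - 1)" unfolding A_def pq r 4 by (rule down) auto
      ultimately show ?thesis by blast
    next
      case 5
      have "A = up_tri M q1 (q2 - 1)" unfolding A_def pq r 5 by (rule up) auto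
      moreover have "B = down_tri M (q1 - 1) (q2 - 1)" unfolding B_def pq r 5 by (rule down) auto
      ultimately show ?thesis by blast
    next
      case 6
      have "B = up_tri M q1 (q2 - 1)" unfolding B_def pq r 6 by (rule up) auto
      moreover have "A = down_tri M q1 (q2 - 1)" unfolding A_def pq r 6 by (rule down) auto
      ultimately show ?thesis by blast
    qed
  qed
  then show "X \<in> ?R" unfolding XAB using AB by (smt (verit) Un_commute mem_Collect_eq)
next
  fix X assume "X \<in> ?R"
  then obtain a b a' b' where X: "X = up_tri M a b \<union> down_tri M a' b'"
    and ab: "(a', b') \<in> {(a, b), (a - 1, b), (a, b - 1)}"
    and sub: "up_tri M a b \<subseteq> hexagon n M" "down_tri M a' b' \<subseteq> hexagon n M" by blast
  have rh: "convex hull {p, q, r} \<union> convex hull {s, q, r} \<in> rhombi n M"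
    if "unit_triangle n M p q r" "unit_triangle n M s q r" "p \<noteq> s" for p q r s
    using that unfolding rhombi_def by blast
  consider "a' = a" "b' = b" | "a' = a - 1" "b' = b" | "a' = a" "b' = b - 1" using ab by auto
  then show "X \<in> rhombi n M"
  proof cases
    case 1
    have u: "up_tri M a b = convex hull {lp M a b, lp M (a + 1) b, lp M a (b + 1)}" by (rule hull_up[symmetric])
    have d: "down_tri M a' b' = convex hull {lp M (a + 1) (b + 1), lp M (a + 1) b, lp M a (b + 1)}"
      unfolding 1 by (rule hull_down[symmetric])
    show ?thesis unfolding X u d
      by (rule rh) (use sub u d in \<open>auto simp: unit_triangle_lp unit_vector_def\<close>)
  next
    case 2
    have u: "up_tri M a b = convex hull {lp M (a + 1) b, lp M a b, lp M a (b + 1)}"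
      unfolding hull_up[symmetric] by (simp only: insert_commute)
    have d: "down_tri M a' b' = convex hull {lp M (a - 1) (b + 1), lp M a b, lp M a (b + 1)}"
      unfolding 2 hull_down[symmetric] by (simp add: insert_commute)
    show ?thesis unfolding X u d
      by (rule rh) (use sub u d in \<open>auto simp: unit_triangle_lp unit_vector_def\<close>)
  next
    case 3
    have u: "up_tri M a b = convex hull {lp M a (b + 1), lp M a b, lp M (a + 1) b}"
      unfolding hull_up[symmetric] by (simp only: insert_commute)
    have d: "down_tri M a' b' = convex hull {lp M (a + 1) (b - 1), lp M a b, lp M (a + 1) b}"
      unfolding 3 hull_down[symmetric] by (simp add: insert_commute)
    show ?thesis unfolding X u d
      by (rule rh) (use sub u d in \<open>auto simp: unit_triangle_lp unit_vector_def\<close>)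
  qed
qed

text \<open>Testing the three corners suffices. They are lattice points, so an inequality for a
  corner shifted by one becomes a strict inequality between integers.\<close>

lemma up_tri_subset_iff:
  assumes "n \<ge> 1" "M \<ge> 1"
  shows "up_tri M a b \<subseteq> hexagon n M \<longleftrightarrow>
    0 \<le> b \<and> b < 2 * int n \<and> - int M - int n \<le> a \<and> a < 0 \<and> - int M \<le> a + b \<and> a + b < int n"
proof
  assume sub: "up_tri M a b \<subseteq> hexagon n M"
  have "lp M a b \<in> hexagon n M" "lp M (a + 1) b \<in> hexagon n M" "lp M a (b + 1) \<in> hexagon n M"
    using sub by (auto simp: up_tri_def)
  then have "real_of_int 0 \<le> of_int b" "real_of_int (b + 1) \<le> of_int (2 * int n)" "real_of_int (- int M - int n) \<le> of_int a"
     "real_of_int (a + 1) \<le> of_int 0" "real_of_int (- int M) \<le> of_int (a + b)" "real_of_int (a + b + 1) \<le> of_int (int n)"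
    unfolding hexagon_eq[OF assms] by auto
  then show "0 \<le> b \<and> b < 2 * int n \<and> - int M - int n \<le> a \<and> a < 0 \<and> - int M \<le> a + b \<and> a + b < int n"
    unfolding of_int_le_iff by auto
next
  assume "0 \<le> b \<and> b < 2 * int n \<and> - int M - int n \<le> a \<and> a < 0 \<and> - int M \<le> a + b \<and> a + b < int n"
  then have "0 \<le> b" "b + 1 \<le> 2 * int n" "- int M - int n \<le> a" "a + 1 \<le> 0" "- int M \<le> a + b" "a + b + 1 \<le> int n"
    by auto
  then have "real_of_int 0 \<le> of_int b" "real_of_int (b + 1) \<le> of_int (2 * int n)" "real_of_int (- int M - int n) \<le> of_int a"
     "real_of_int (a + 1) \<le> of_int 0" "real_of_int (- int M) \<le> of_int (a + b)" "real_of_int (a + b + 1) \<le> of_int (int n)"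
    unfolding of_int_le_iff by auto
  then show "up_tri M a b \<subseteq> hexagon n M"
    unfolding hexagon_eq[OF assms] by (auto simp: up_tri_def)
qed

lemma down_tri_subset_iff:
  assumes "n \<ge> 1" "M \<ge> 1"
  shows "down_tri M a b \<subseteq> hexagon n M \<longleftrightarrow>
    0 \<le> b \<and> b < 2 * int n \<and> - int M - int n \<le> a \<and> a < 0 \<and> - int M \<le> a + b + 1 \<and> a + b + 1 < int n"
proof
  assume sub: "down_tri M a b \<subseteq> hexagon n M"
  have "lp M (a + 1) (b + 1) \<in> hexagon n M" "lp M (a + 1) b \<in> hexagon n M" "lp M a (b + 1) \<in> hexagon n M"
    using sub by (auto simp: down_tri_def)
  then have "real_of_int 0 \<le> of_int b" "real_of_int (b + 1) \<le> of_int (2 * int n)" "real_of_int (- int M - int n) \<le> of_int a"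
     "real_of_int (a + 1) \<le> of_int 0" "real_of_int (- int M) \<le> of_int (a + b + 1)" "real_of_int (a + b + 2) \<le> of_int (int n)"
    unfolding hexagon_eq[OF assms] by auto
  then show "0 \<le> b \<and> b < 2 * int n \<and> - int M - int n \<le> a \<and> a < 0 \<and> - int M \<le> a + b + 1 \<and> a + b + 1 < int n"
    unfolding of_int_le_iff by auto
next
  assume "0 \<le> b \<and> b < 2 * int n \<and> - int M - int n \<le> a \<and> a < 0 \<and> - int M \<le> a + b + 1 \<and> a + b + 1 < int n"
  then have "0 \<le> b" "b + 1 \<le> 2 * int n" "- int M - int n \<le> a" "a + 1 \<le> 0" "- int M \<le> a + b + 1" "a + b + 2 \<le> int n"
    by auto
  then have "real_of_int 0 \<le> of_int b" "real_of_int (b + 1) \<le> of_int (2 * int n)" "real_of_int (- int M - int n) \<le> of_int a"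
     "real_of_int (a + 1) \<le> of_int 0" "real_of_int (- int M) \<le> of_int (a + b + 1)" "real_of_int (a + b + 2) \<le> of_int (int n)"
    unfolding of_int_le_iff by auto
  then show "down_tri M a b \<subseteq> hexagon n M"
    unfolding hexagon_eq[OF assms] by (auto simp: down_tri_def)
qed

section \<open>Tiles indexed by pairs of sites\<close>

text \<open>Heights count downwards: edge \<open>(t, y)\<close> spans lattice coordinates
  \<open>- 1 - y\<close> to \<open>- y\<close> in column \<open>t\<close>. \<open>left_tri\<close>
  lowers the column by one because \<open>down_tri M a b\<close> has its vertical edge in column
  \<open>b + 1\<close>.\<close>

definition right_tri :: "nat \<Rightarrow> nat \<times> int \<Rightarrow> (real \<times> real) set" where
  "right_tri M u = up_tri M (- 1 - snd u) (int (fst u))"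

definition left_tri :: "nat \<Rightarrow> nat \<times> int \<Rightarrow> (real \<times> real) set" where
  "left_tri M d = down_tri M (- 1 - snd d) (int (fst d) - 1)"

definition tile :: "nat \<Rightarrow> (nat \<times> int) \<times> (nat \<times> int) \<Rightarrow> (real \<times> real) set" where
  "tile M z = right_tri M (fst z) \<union> left_tri M (snd z)"

lemma up_tri_site:
  assumes "n \<ge> 1" "M \<ge> 1" "up_tri M a b \<subseteq> hexagon n M"
  shows "(nat b, - 1 - a) \<in> sites n M" "nat b < 2 * n" "b \<ge> 0"
  using assms by (auto simp: up_tri_subset_iff sites_def)

lemma down_tri_site:
  assumes "n \<ge> 1" "M \<ge> 1" "down_tri M a b \<subseteq> hexagon n M"
  shows "(nat (b + 1), - 1 - a) \<in> sites n M" "0 < nat (b + 1)" "b \<ge> 0"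
  using assms by (auto simp: down_tri_subset_iff sites_def)

lemma right_tri_subset:
  assumes "n \<ge> 1" "M \<ge> 1" "u \<in> sites n M" "fst u < 2 * n"
  shows "right_tri M u \<subseteq> hexagon n M"
  using assms by (auto simp: up_tri_subset_iff sites_def right_tri_def)

lemma left_tri_subset:
  assumes "n \<ge> 1" "M \<ge> 1" "d \<in> sites n M" "0 < fst d"
  shows "left_tri M d \<subseteq> hexagon n M"
  using assms by (auto simp: down_tri_subset_iff sites_def left_tri_def)

lemma rhombi_eq_tiles:
  assumes "n \<ge> 1" "M \<ge> 1"
  shows "rhombi n M = tile M ` site_pairs n M"
proof (intro equalityI subsetI)
  fix X assume "X \<in> rhombi n M"
  then obtain a b a' b' where X: "X = up_tri M a b \<union> down_tri M a' b'"
    and ab: "(a', b') \<in> {(a, b), (a - 1, b), (a, b - 1)}"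
    and sub: "up_tri M a b \<subseteq> hexagon n M" "down_tri M a' b' \<subseteq> hexagon n M"
    unfolding rhombi_eq by blast
  let ?u = "(nat b, - 1 - a)" and ?d = "(nat (b' + 1), - 1 - a')"
  note s = up_tri_site[OF assms sub(1)] down_tri_site[OF assms sub(2)]
  have "adjacent ?u ?d" using ab s by (auto simp: adjacent_def)
  then have "(?u, ?d) \<in> site_pairs n M" using s by (simp add: site_pairs_def)
  moreover have "X = tile M (?u, ?d)" using s by (simp add: X tile_def right_tri_def left_tri_def)
  ultimately show "X \<in> tile M ` site_pairs n M" by blast
next
  fix X assume "X \<in> tile M ` site_pairs n M"
  then obtain u d where ud: "(u, d) \<in> site_pairs n M" and X: "X = tile M (u, d)" by auto
  have sub: "right_tri M u \<subseteq> hexagon n M" "left_tri M d \<subseteq> hexagon n M"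
    using ud assms by (auto simp: site_pairs_def right_tri_subset left_tri_subset)
  have "(- 1 - snd d, int (fst d) - 1) \<in> {(- 1 - snd u, int (fst u)), (- 1 - snd u - 1, int (fst u)), (- 1 - snd u, int (fst u) - 1)}"
    using ud by (auto simp: site_pairs_def adjacent_def)
  then show "X \<in> rhombi n M"
    using sub unfolding rhombi_eq X tile_def right_tri_def left_tri_def fst_conv snd_conv by blast
qed

section \<open>Test points, interiors and covering\<close>

text \<open>The centroid. It lies in the interior of its own triangle and in no other unit triangle,
  so the tiles containing it are known exactly.\<close>

definition up_centre :: "nat \<Rightarrow> int \<Rightarrow> int \<Rightarrow> real \<times> real" where
  "up_centre M a b = pt M (of_int a + 1 / 3) (of_int b + 1 / 3)"

definition down_centre :: "nat \<Rightarrow> int \<Rightarrow> int \<Rightarrow> real \<times> real" where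
  "down_centre M a b = pt M (of_int a + 2 / 3) (of_int b + 2 / 3)"

lemma up_centre_in_up_tri: "up_centre M a b \<in> up_tri M a' b' \<longleftrightarrow> a = a' \<and> b = b'"
proof
  assume "up_centre M a b \<in> up_tri M a' b'"
  then have "real_of_int a' < of_int (a + 1)" "real_of_int b' < of_int (b + 1)" "real_of_int (a + b) < of_int (a' + b' + 1)"
    by (auto simp: up_centre_def up_tri_def)
  then show "a = a' \<and> b = b'" unfolding of_int_less_iff by auto
qed (auto simp: up_centre_def up_tri_def)

lemma up_centre_not_in_down_tri: "up_centre M a b \<notin> down_tri M a' b'"
proof
  assume "up_centre M a b \<in> down_tri M a' b'"
  then have "real_of_int a < of_int (a' + 1)" "real_of_int b < of_int (b' + 1)" "real_of_int (a' + b' + 1) < of_int (a + b + 1)"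
    by (auto simp: up_centre_def down_tri_def)
  then show False unfolding of_int_less_iff by auto
qed

lemma down_centre_in_down_tri: "down_centre M a b \<in> down_tri M a' b' \<longleftrightarrow> a = a' \<and> b = b'"
proof
  assume "down_centre M a b \<in> down_tri M a' b'"
  then have "real_of_int a < of_int (a' + 1)" "real_of_int b < of_int (b' + 1)" "real_of_int (a' + b' + 1) < of_int (a + b + 2)"
    by (auto simp: down_centre_def down_tri_def)
  then show "a = a' \<and> b = b'" unfolding of_int_less_iff by auto
qed (auto simp: down_centre_def down_tri_def)

lemma down_centre_not_in_up_tri: "down_centre M a b \<notin> up_tri M a' b'"
proof
  assume "down_centre M a b \<in> up_tri M a' b'"
  then have "real_of_int a' < of_int (a + 1)" "real_of_int b' < of_int (b + 1)" "real_of_int (a + b + 1) < of_int (a' + b' + 1)"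
    by (auto simp: down_centre_def up_tri_def)
  then show False unfolding of_int_less_iff by auto
qed

lemma continuous_ci: "continuous_on S (ci M)" and continuous_cj: "continuous_on S cj"
  unfolding ci_def cj_def by (intro continuous_intros; simp)+

lemma up_centre_interior: "up_centre M a b \<in> interior (up_tri M a b)"
proof (rule interiorI)
  show "open {p. of_int a < ci M p \<and> of_int b < cj p \<and> ci M p + cj p < of_int a + of_int b + 1}"
    by (intro open_Collect_conj open_Collect_less continuous_intros continuous_ci continuous_cj)
qed (auto simp: up_centre_def up_tri_def)

lemma down_centre_interior: "down_centre M a b \<in> interior (down_tri M a b)"
proof (rule interiorI)
  show "open {p. ci M p < of_int a + 1 \<and> cj p < of_int b + 1 \<and> of_int a + of_int b + 1 < ci M p + cj p}"
    by (intro open_Collect_conj open_Collect_less continuous_intros continuous_ci continuous_cj)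
qed (auto simp: down_centre_def down_tri_def)

lemma closed_up_tri: "closed (up_tri M a b)"
  unfolding up_tri_def by (intro closed_Collect_conj closed_Collect_le continuous_intros continuous_ci continuous_cj)

lemma closed_down_tri: "closed (down_tri M a b)"
  unfolding down_tri_def by (intro closed_Collect_conj closed_Collect_le continuous_intros continuous_ci continuous_cj)

lemma interior_line:
  assumes "\<alpha> \<noteq> 0 \<or> \<beta> \<noteq> 0"
  shows "interior {p. \<alpha> * ci M p + \<beta> * cj p = c} = {}"
proof -
  \<comment> \<open>The normal vector of the line in Cartesian coordinates.\<close>
  define v :: "real \<times> real" where "v = ((2 * \<beta> - \<alpha>) / sqrt 3, \<alpha>)"
  have "{p. \<alpha> * ci M p + \<beta> * cj p = c} = {p. v \<bullet> p = c + \<alpha> * (real M / 2)}"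
    by (auto simp: v_def ci_def cj_def inner_prod_def field_simps)
  moreover have "v \<noteq> 0" using assms by (auto simp: v_def zero_prod_def)
  ultimately show ?thesis by simp
qed

lemma interior_subset_line:
  assumes "\<alpha> \<noteq> 0 \<or> \<beta> \<noteq> 0" "\<And>p. p \<in> S \<Longrightarrow> \<alpha> * ci M p + \<beta> * cj p = c"
  shows "interior S = {}"
proof -
  have "S \<subseteq> {p. \<alpha> * ci M p + \<beta> * cj p = c}" using assms(2) by blast
  from interior_mono[OF this] show ?thesis unfolding interior_line[OF assms(1)] by blast
qed

lemma tri_bounds:
  "p \<in> up_tri M a b \<Longrightarrow> ci M p \<le> of_int (a + 1) \<and> cj p \<le> of_int (b + 1) \<and> of_int a \<le> ci M p \<and> of_int b \<le> cj p"
  "p \<in> down_tri M a b \<Longrightarrow> ci M p \<le> of_int (a + 1) \<and> cj p \<le> of_int (b + 1) \<and> of_int a \<le> ci M p \<and> of_int b \<le> cj p"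
  by (auto simp: up_tri_def down_tri_def)

text \<open>Unit boxes with distinct integer corners in lattice coordinates overlap at most along a
  lattice line.\<close>

lemma interior_boxes:
  assumes S: "\<And>p. p \<in> S \<Longrightarrow> ci M p \<le> of_int (a + 1) \<and> cj p \<le> of_int (b + 1) \<and> of_int a \<le> ci M p \<and> of_int b \<le> cj p"
    and S': "\<And>p. p \<in> S' \<Longrightarrow> ci M p \<le> of_int (a' + 1) \<and> cj p \<le> of_int (b' + 1) \<and> of_int a' \<le> ci M p \<and> of_int b' \<le> cj p"
    and "a \<noteq> a' \<or> b \<noteq> b'"
  shows "interior (S \<inter> S') = {}"
proof -
  have le: "of_int (k + 1) \<le> (of_int k' :: real)" if "k < k'" for k k' :: int
    using that unfolding of_int_le_iff by simp
  consider "a < a'" | "a' < a" | "b < b'" | "b' < b" using assms(3) by linarith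
  then show ?thesis
  proof cases
    case 1
    show ?thesis
      by (rule interior_subset_line[of 1 0 _ M "of_int a'"]) (use S S' le[OF 1] in \<open>force simp del: of_int_add\<close>)+
  next
    case 2
    show ?thesis
      by (rule interior_subset_line[of 1 0 _ M "of_int a"]) (use S S' le[OF 2] in \<open>force simp del: of_int_add\<close>)+
  next
    case 3
    show ?thesis
      by (rule interior_subset_line[of 0 1 _ M "of_int b'"]) (use S S' le[OF 3] in \<open>force simp del: of_int_add\<close>)+
  next
    case 4
    show ?thesis
      by (rule interior_subset_line[of 0 1 _ M "of_int b"]) (use S S' le[OF 4] in \<open>force simp del: of_int_add\<close>)+
  qed
qed

lemma interior_up_up: "(a, b) \<noteq> (a', b') \<Longrightarrow> interior (up_tri M a b \<inter> up_tri M a' b') = {}"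
  by (rule interior_boxes[OF tri_bounds(1) tri_bounds(1)]) auto

lemma interior_down_down: "(a, b) \<noteq> (a', b') \<Longrightarrow> interior (down_tri M a b \<inter> down_tri M a' b') = {}"
  by (rule interior_boxes[OF tri_bounds(2) tri_bounds(2)]) auto

text \<open>In a common box the two triangles meet only in the diagonal on which
  \<open>ci M p + cj p = a + b + 1\<close>.\<close>

lemma interior_up_down: "interior (up_tri M a b \<inter> down_tri M a' b') = {}"
proof (cases "a = a' \<and> b = b'")
  case True
  then show ?thesis
    by (intro interior_subset_line[of 1 1 _ M "of_int a + of_int b + 1"]) (auto simp: up_tri_def down_tri_def)
next
  case False
  then show ?thesis by (intro interior_boxes[OF tri_bounds(1) tri_bounds(2)]) auto
qed

text \<open>The intersection of two tiles is a union of four pairwise triangle intersections. Each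
  has empty interior, and closedness is what allows this to pass to the union.\<close>

lemma interior_tiles_disjoint:
  assumes "u \<noteq> u'" "d \<noteq> d'"
  shows "interior (tile M (u, d)) \<inter> interior (tile M (u', d')) = {}"
proof -
  let ?A = "right_tri M u \<inter> right_tri M u'" and ?B = "right_tri M u \<inter> left_tri M d'"
    and ?C = "right_tri M u' \<inter> left_tri M d" and ?D = "left_tri M d \<inter> left_tri M d'"
  have cl: "closed ?A" "closed ?B" "closed ?C" "closed ?D"
    by (auto simp: right_tri_def left_tri_def closed_up_tri closed_down_tri intro!: closed_Int)
  have int: "interior ?A = {}" "interior ?B = {}" "interior ?C = {}" "interior ?D = {}"
    unfolding right_tri_def left_tri_def
    subgoal using assms by (intro interior_up_up) (auto simp: prod_eq_iff)
    subgoal by (rule interior_up_down)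
    subgoal by (rule interior_up_down)
    subgoal using assms by (intro interior_down_down) (auto simp: prod_eq_iff)
    done
  have "interior (tile M (u, d)) \<inter> interior (tile M (u', d')) = interior (((?A \<union> ?B) \<union> ?C) \<union> ?D)"
    unfolding interior_Int[symmetric] by (rule arg_cong[where f = interior]) (auto simp: tile_def)
  also have "\<dots> = {}"
    using cl int by (simp add: interior_closed_Un_empty_interior closed_Un)
  finally show ?thesis .
qed

text \<open>The point is located in a unit box and the diagonal selects the triangle. The delicate
  points are on the boundary, where the selected triangle may stick out of the hexagon and a
  neighbour has to be used.\<close>

lemma hexagon_covered:
  assumes "n \<ge> 1" "M \<ge> 1" "p \<in> hexagon n M"
  shows "\<exists>a b. (p \<in> up_tri M a b \<and> up_tri M a b \<subseteq> hexagon n M) \<or> (p \<in> down_tri M a b \<and> down_tri M a b \<subseteq> hexagon n M)"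
proof -
  define x y where "x = ci M p" and "y = cj p"
  have xy: "0 \<le> y" "y \<le> 2 * real n" "- real M - real n \<le> x" "x \<le> 0" "- real M \<le> x + y" "x + y \<le> real n"
    using assms(3) unfolding hexagon_eq[OF assms(1,2)] by (auto simp: x_def y_def)
  \<comment> \<open>The caps keep points with \<open>ci M p = 0\<close> or
    \<open>cj p = 2 * n\<close> in the last box inside the hexagon.\<close>
  define a where "a = min \<lfloor>x\<rfloor> (- 1)"
  define b where "b = min \<lfloor>y\<rfloor> (2 * int n - 1)"
  have a: "of_int a \<le> x" "x \<le> of_int a + 1"
    using xy by (auto simp: a_def min_def) linarith+
  have b: "of_int b \<le> y" "y \<le> of_int b + 1"
    using xy by (auto simp: b_def min_def) linarith+
  have a': "a < 0" "- int M - int n \<le> a" "0 \<le> b" "b < 2 * int n"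
    using xy assms by (auto simp: a_def b_def le_floor_iff)
  consider "x + y \<le> of_int a + of_int b + 1" "- int M \<le> a + b" "a + b < int n"
    | "x + y \<le> of_int a + of_int b + 1" "- int M \<le> a + b" "a + b \<ge> int n"
    | "of_int a + of_int b + 1 \<le> x + y" "a + b + 1 < int n" "- int M \<le> a + b + 1"
    | "of_int a + of_int b + 1 \<le> x + y" "a + b + 1 < int n" "a + b + 1 < - int M"
  proof (cases "x + y \<le> of_int a + of_int b + 1")
    case True
    have "real_of_int (- int M) \<le> of_int (a + b + 1)" using True xy by simp
    then have ge: "- int M \<le> a + b + 1" unfolding of_int_le_iff .
    show thesis
    proof (cases "- int M \<le> a + b")
      case True
      then show thesis using \<open>x + y \<le> of_int a + of_int b + 1\<close> that(1,2) by linarith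
    next
      case False
      then have eq: "a + b + 1 = - int M" using ge by simp
      then have "real_of_int (a + b + 1) = of_int (- int M)" by (simp only:)
      then have "of_int a + of_int b + 1 \<le> x + y" using xy by simp
      then show thesis using eq that(3) assms by simp
    qed
  next
    case False
    then have "real_of_int (a + b + 1) < of_int (int n)" using xy by simp
    then have "a + b + 1 < int n" unfolding of_int_less_iff .
    then show thesis using False that(3,4) by linarith
  qed
  then show ?thesis
  proof cases
    case 1
    then have "up_tri M a b \<subseteq> hexagon n M" using a' assms by (simp add: up_tri_subset_iff)
    moreover have "p \<in> up_tri M a b" using 1 a b by (simp add: up_tri_def flip: x_def y_def)
    ultimately show ?thesis by blast
  next
    case 2
    \<comment> \<open>Here the point is a lattice point on the side \<open>x + y = n\<close>; it is
      a corner of the left-pointing triangle of the box below and to the left.\<close>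
    then have "real_of_int (int n) \<le> of_int (a + b)" unfolding of_int_le_iff by simp
    then have eq: "x = of_int a" "y = of_int b" "real_of_int (a + b) = of_int (int n)" using xy a b by auto
    then have "a + b = int n" unfolding of_int_eq_iff by simp
    then have "down_tri M (a - 1) (b - 1) \<subseteq> hexagon n M" using a' assms by (simp add: down_tri_subset_iff)
    moreover have "p \<in> down_tri M (a - 1) (b - 1)" using eq by (simp add: down_tri_def flip: x_def y_def)
    ultimately show ?thesis by blast
  next
    case 3
    then have "down_tri M a b \<subseteq> hexagon n M" using a' assms by (simp add: down_tri_subset_iff)
    moreover have "p \<in> down_tri M a b" using 3 a b by (simp add: down_tri_def flip: x_def y_def)
    ultimately show ?thesis by blast
  next
    case 4
    \<comment> \<open>An impossible case: the point would be the far corner of its box, so the cap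
      was active and \<open>a = - 1\<close>, against \<open>b \<ge> 0\<close>.\<close>
    then have "a + b + 2 \<le> - int M" by simp
    then have "real_of_int (a + b + 2) \<le> of_int (- int M)" unfolding of_int_le_iff .
    then have "x = of_int (a + 1)" using xy a b by simp
    then have "\<lfloor>x\<rfloor> = a + 1" by (simp only: floor_of_int)
    then have "a = - 1" by (simp add: a_def min_def split: if_splits)
    then show ?thesis using 4 a' by simp
  qed
qed

lemma tile_subset:
  assumes "n \<ge> 1" "M \<ge> 1" "z \<in> site_pairs n M"
  shows "tile M z \<subseteq> hexagon n M"
proof -
  have "fst z \<in> sites n M" "fst (fst z) < 2 * n" "snd z \<in> sites n M" "0 < fst (snd z)"
    using assms(3) by (auto simp: site_pairs_def)
  then show ?thesis
    using right_tri_subset[OF assms(1,2), of "fst z"] left_tri_subset[OF assms(1,2), of "snd z"]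
    unfolding tile_def by blast
qed

definition right_centre :: "nat \<Rightarrow> nat \<times> int \<Rightarrow> real \<times> real" where
  "right_centre M u = up_centre M (- 1 - snd u) (int (fst u))"

definition left_centre :: "nat \<Rightarrow> nat \<times> int \<Rightarrow> real \<times> real" where
  "left_centre M d = down_centre M (- 1 - snd d) (int (fst d) - 1)"

lemma right_centre_in_tile: "right_centre M u \<in> tile M z \<longleftrightarrow> u = fst z"
  by (auto simp: right_centre_def tile_def right_tri_def left_tri_def up_centre_in_up_tri up_centre_not_in_down_tri prod_eq_iff)

lemma left_centre_in_tile: "left_centre M d \<in> tile M z \<longleftrightarrow> d = snd z"
  by (auto simp: left_centre_def tile_def right_tri_def left_tri_def down_centre_in_down_tri down_centre_not_in_up_tri prod_eq_iff)

lemma right_centre_interior: "right_centre M (fst z) \<in> interior (tile M z)"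
  using interior_mono[of "right_tri M (fst z)" "tile M z"] up_centre_interior
  by (force simp: right_centre_def right_tri_def tile_def)

lemma left_centre_interior: "left_centre M (snd z) \<in> interior (tile M z)"
  using interior_mono[of "left_tri M (snd z)" "tile M z"] down_centre_interior
  by (force simp: left_centre_def left_tri_def tile_def)

lemma inj_tile: "inj (tile M)"
proof (rule injI)
  fix z z' assume "tile M z = tile M z'"
  then show "z = z'"
    using right_centre_in_tile[of M "fst z" z] right_centre_in_tile[of M "fst z" z']
      left_centre_in_tile[of M "snd z" z] left_centre_in_tile[of M "snd z" z'] by (simp add: prod_eq_iff)
qed

section \<open>Tilings as perfect matchings\<close>

lemma rhombus_tiling_tiles:
  assumes nM: "n \<ge> 1" "M \<ge> 1" and \<mu>: "\<mu> \<in> matchings n M"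
  shows "rhombus_tiling n M (tile M ` \<mu>)"
  unfolding rhombus_tiling_def
proof (intro conjI)
  have sub: "\<mu> \<subseteq> site_pairs n M" using \<mu> by (simp add: matchings_def)
  then show "tile M ` \<mu> \<subseteq> rhombi n M" unfolding rhombi_eq_tiles[OF nM] by blast
  have exu: "\<exists>!d. (u, d) \<in> \<mu>" if "u \<in> sites n M" "fst u < 2 * n" for u
    using \<mu> that by (simp add: matchings_def)
  have exd: "\<exists>!u. (u, d) \<in> \<mu>" if "d \<in> sites n M" "0 < fst d" for d
    using \<mu> that by (simp add: matchings_def)
  show "pairwise (\<lambda>A B. interior A \<inter> interior B = {}) (tile M ` \<mu>)"
  proof (rule pairwiseI)
    fix A B assume AB: "A \<in> tile M ` \<mu>" "B \<in> tile M ` \<mu>" "A \<noteq> B"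
    then obtain y y' where y: "y \<in> \<mu>" "y' \<in> \<mu>" "A = tile M y" "B = tile M y'" by blast
    obtain u d u' d' where "y = (u, d)" "y' = (u', d')" by (metis surj_pair)
    then have z: "(u, d) \<in> \<mu>" "(u', d') \<in> \<mu>" "A = tile M (u, d)" "B = tile M (u', d')" using y by auto
    have "u \<in> sites n M" "fst u < 2 * n" "d \<in> sites n M" "0 < fst d"
      using z sub by (auto simp: site_pairs_def)
    then have "\<exists>!d. (u, d) \<in> \<mu>" "\<exists>!u. (u, d) \<in> \<mu>" using exu exd by auto
    then have "u = u' \<longleftrightarrow> d = d'" using z by metis
    then show "interior A \<inter> interior B = {}"
      using AB(3) unfolding z by (intro interior_tiles_disjoint) auto
  qed
  show "\<Union> (tile M ` \<mu>) = hexagon n M"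
  proof (intro equalityI subsetI)
    show "p \<in> hexagon n M" if "p \<in> \<Union> (tile M ` \<mu>)" for p
      using that sub tile_subset[OF nM] by blast
  next
    fix p assume "p \<in> hexagon n M"
    then obtain a b where "(p \<in> up_tri M a b \<and> up_tri M a b \<subseteq> hexagon n M) \<or> (p \<in> down_tri M a b \<and> down_tri M a b \<subseteq> hexagon n M)"
      using hexagon_covered[OF nM] by blast
    then show "p \<in> \<Union> (tile M ` \<mu>)"
    proof (elim disjE conjE)
      assume p: "p \<in> up_tri M a b" "up_tri M a b \<subseteq> hexagon n M"
      note s = up_tri_site[OF nM p(2)]
      then obtain d where "((nat b, - 1 - a), d) \<in> \<mu>" using exu[of "(nat b, - 1 - a)"] by (metis fst_conv)
      moreover have "p \<in> tile M ((nat b, - 1 - a), d)" using p s by (simp add: tile_def right_tri_def)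
      ultimately show ?thesis by blast
    next
      assume p: "p \<in> down_tri M a b" "down_tri M a b \<subseteq> hexagon n M"
      note s = down_tri_site[OF nM p(2)]
      then obtain u where "(u, (nat (b + 1), - 1 - a)) \<in> \<mu>" using exd[of "(nat (b + 1), - 1 - a)"] by (metis fst_conv)
      moreover have "p \<in> tile M (u, (nat (b + 1), - 1 - a))" using p s by (simp add: tile_def left_tri_def)
      ultimately show ?thesis by blast
    qed
  qed
qed

text \<open>The centroid of each unit triangle has to be covered, which gives a partner. Two tiles
  covering it share an interior point, so they coincide, and \<open>inj_tile\<close> makes the
  partner unique.\<close>

lemma rhombus_tiling_imp_tiles:
  assumes nM: "n \<ge> 1" "M \<ge> 1" and T: "rhombus_tiling n M T"
  shows "T \<in> (\<lambda>\<mu>. tile M ` \<mu>) ` matchings n M"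
proof -
  define \<mu> where "\<mu> = {z \<in> site_pairs n M. tile M z \<in> T}"
  have TU: "\<Union>T = hexagon n M" and dis: "\<And>A B. A \<in> T \<Longrightarrow> B \<in> T \<Longrightarrow> A \<noteq> B \<Longrightarrow> interior A \<inter> interior B = {}"
    using T by (auto simp: rhombus_tiling_def pairwise_def)
  have T\<mu>: "T = tile M ` \<mu>"
    using T unfolding rhombus_tiling_def rhombi_eq_tiles[OF nM] \<mu>_def by blast
  have same: "z = z'" if "z \<in> \<mu>" "z' \<in> \<mu>" "p \<in> interior (tile M z)" "p \<in> interior (tile M z')" for z z' p
  proof -
    have "tile M z = tile M z'" using dis[of "tile M z" "tile M z'"] that by (auto simp: \<mu>_def)
    then show ?thesis by (rule injD[OF inj_tile])
  qed
  have "\<mu> \<in> matchings n M"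
    unfolding matchings_def
  proof (intro CollectI conjI ballI impI)
    show "\<mu> \<subseteq> site_pairs n M" by (auto simp: \<mu>_def)
  next
    fix u assume u: "u \<in> sites n M" "fst u < 2 * n"
    have "right_centre M u \<in> right_tri M u"
      by (simp add: right_centre_def right_tri_def up_centre_in_up_tri)
    then have "right_centre M u \<in> \<Union>T" unfolding TU using right_tri_subset[OF nM u] by blast
    then obtain z where z: "z \<in> \<mu>" "right_centre M u \<in> tile M z" unfolding T\<mu> by blast
    then have zu: "(u, snd z) \<in> \<mu>" by (simp add: right_centre_in_tile)
    show "\<exists>!d. (u, d) \<in> \<mu>"
    proof (rule ex1I[of _ "snd z"])
      show "(u, snd z) \<in> \<mu>" by (rule zu)
      fix d assume "(u, d) \<in> \<mu>"
      from same[OF this zu] show "d = snd z"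
        using right_centre_interior[of M "(u, d)"] right_centre_interior[of M "(u, snd z)"] by simp
    qed
  next
    fix d assume d: "d \<in> sites n M" "0 < fst d"
    have "left_centre M d \<in> left_tri M d"
      by (simp add: left_centre_def left_tri_def down_centre_in_down_tri)
    then have "left_centre M d \<in> \<Union>T" unfolding TU using left_tri_subset[OF nM d] by blast
    then obtain z where z: "z \<in> \<mu>" "left_centre M d \<in> tile M z" unfolding T\<mu> by blast
    then have zd: "(fst z, d) \<in> \<mu>" by (simp add: left_centre_in_tile)
    show "\<exists>!u. (u, d) \<in> \<mu>"
    proof (rule ex1I[of _ "fst z"])
      show "(fst z, d) \<in> \<mu>" by (rule zd)
      fix u assume "(u, d) \<in> \<mu>"
      from same[OF this zd] show "u = fst z"
        using left_centre_interior[of M "(u, d)"] left_centre_interior[of M "(fst z, d)"] by simp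
    qed
  qed
  then show ?thesis using T\<mu> by blast
qed

section \<open>The rhombus on the axis\<close>

text \<open>The union of the two triangles is an intersection of two lattice strips, hence convex,
  so it absorbs the hull of its corners.\<close>

lemma up_down_rhombus:
  "convex hull {lp M (a + 1) (b - 1), lp M a (b + 1), lp M (a + 1) b, lp M a b} = up_tri M a b \<union> down_tri M a (b - 1)"
proof (intro equalityI Un_least)
  have "up_tri M a b \<union> down_tri M a (b - 1) =
    {p. (-1) * ci M p + 0 * cj p \<le> - of_int a} \<inter> {p. 1 * ci M p + 0 * cj p \<le> of_int a + 1}
    \<inter> {p. (-1) * ci M p + (-1) * cj p \<le> - of_int a - of_int b} \<inter> {p. 1 * ci M p + 1 * cj p \<le> of_int a + of_int b + 1}"
    by (auto simp: up_tri_def down_tri_def)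
  then have "convex (up_tri M a b \<union> down_tri M a (b - 1))"
    by (simp only:) (intro convex_Int convex_ci_cj_le)
  then show "convex hull {lp M (a + 1) (b - 1), lp M a (b + 1), lp M (a + 1) b, lp M a b} \<subseteq> up_tri M a b \<union> down_tri M a (b - 1)"
    by (intro hull_minimal) (auto simp: up_tri_def down_tri_def)
  show "up_tri M a b \<subseteq> convex hull {lp M (a + 1) (b - 1), lp M a (b + 1), lp M (a + 1) b, lp M a b}"
    unfolding hull_up[symmetric] by (rule hull_mono) auto
  show "down_tri M a (b - 1) \<subseteq> convex hull {lp M (a + 1) (b - 1), lp M a (b + 1), lp M (a + 1) b, lp M a b}"
    unfolding hull_down[symmetric] by (rule hull_mono) auto
qed

lemma axis_rhombus_eq_tile:
  assumes "m \<ge> 1"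
  shows "axis_rhombus l = tile (2 * m - 1) ((2 * l, int (m - 1 + l)), (2 * l, int (m - 1 + l)))"
proof -
  \<comment> \<open>The first lattice coordinate of the lower end
    \<open>(l * sqrt 3, - 1 / 2)\<close> of the short diagonal, in column
    \<open>2 * l\<close>.\<close>
  define a where "a = - int m - int l"
  have r: "real (2 * m - 1) = 2 * real m - 1" using assms by (simp add: of_nat_diff)
  have "axis_rhombus l = convex hull {lp (2 * m - 1) (a + 1) (2 * int l - 1), lp (2 * m - 1) a (2 * int l + 1),
     lp (2 * m - 1) (a + 1) (2 * int l), lp (2 * m - 1) a (2 * int l)}"
    unfolding axis_rhombus_def lp_def pt_def r a_def
    by (rule arg_cong[where f = "\<lambda>S. convex hull S"]) (simp add: field_simps)
  also have "\<dots> = up_tri (2 * m - 1) a (2 * int l) \<union> down_tri (2 * m - 1) a (2 * int l - 1)"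
    by (rule up_down_rhombus)
  also have "a = - 1 - int (m - 1 + l)" using assms by (simp add: a_def of_nat_diff)
  finally show ?thesis by (simp add: tile_def right_tri_def left_tri_def)
qed

lemma card_tilings_with_axis_rhombus:
  assumes "n \<ge> 1" "m \<ge> 1"
  shows "card {T. rhombus_tiling n (2 * m - 1) T \<and> axis_rhombus l \<in> T}
    = card {\<mu> \<in> matchings n (2 * m - 1). ((2 * l, int (m - 1 + l)), (2 * l, int (m - 1 + l))) \<in> \<mu>}"
proof -
  let ?M = "2 * m - 1" and ?z = "((2 * l, int (m - 1 + l)), (2 * l, int (m - 1 + l)))"
  have M: "?M \<ge> 1" using assms by simp
  have mem: "axis_rhombus l \<in> tile ?M ` \<mu> \<longleftrightarrow> ?z \<in> \<mu>" for \<mu>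
    unfolding axis_rhombus_eq_tile[OF assms(2)] by (rule inj_image_mem_iff[OF inj_tile])
  have "{T. rhombus_tiling n ?M T \<and> axis_rhombus l \<in> T} = (\<lambda>\<mu>. tile ?M ` \<mu>) ` {\<mu> \<in> matchings n ?M. ?z \<in> \<mu>}"
  proof (intro equalityI subsetI)
    fix T assume T: "T \<in> {T. rhombus_tiling n ?M T \<and> axis_rhombus l \<in> T}"
    then obtain \<mu> where \<mu>: "\<mu> \<in> matchings n ?M" "T = tile ?M ` \<mu>"
      using rhombus_tiling_imp_tiles[OF assms(1) M, of T] by blast
    moreover have "?z \<in> \<mu>" using T mem[of \<mu>] unfolding \<mu>(2) by simp
    ultimately show "T \<in> (\<lambda>\<mu>. tile ?M ` \<mu>) ` {\<mu> \<in> matchings n ?M. ?z \<in> \<mu>}" by blast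
  next
    fix T assume "T \<in> (\<lambda>\<mu>. tile ?M ` \<mu>) ` {\<mu> \<in> matchings n ?M. ?z \<in> \<mu>}"
    then obtain \<mu> where \<mu>: "\<mu> \<in> matchings n ?M" "?z \<in> \<mu>" "T = tile ?M ` \<mu>" by blast
    then show "T \<in> {T. rhombus_tiling n ?M T \<and> axis_rhombus l \<in> T}"
      using rhombus_tiling_tiles[OF assms(1) M \<mu>(1)] mem[of \<mu>] by simp
  qed
  moreover have "inj (\<lambda>\<mu>. tile ?M ` \<mu>)"
    using inj_tile by (simp add: inj_def inj_image_eq_iff)
  ultimately show ?thesis by (simp add: card_image inj_on_subset)
qed

theorem theorem2:
  fixes m N l :: nat
  assumes "1 \<le> m" and "1 \<le> N" and "1 \<le> l" and "l \<le> N"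
  shows "real (card {T. rhombus_tiling (N + 1) (2 * m - 1) T \<and> axis_rhombus l \<in> T}) =
    real m * real ((m + N) choose m) * real ((m + N - 1) choose m)
      / real ((2 * m + 2 * N - 1) choose (2 * m))
    * (\<Sum>e = 0..l - 1. (- 1) ^ e * real (N choose e) *
        ((real N - 2 * real e) * pochhammer (1 / 2) e)
          / ((real m + real e) * (real m + real N - real e) * pochhammer (1 / 2 - real N) e))
    * (\<Prod>i = 1..N + 1. \<Prod>j = 1..N + 1. \<Prod>k = 1..2 * m - 1.
        (real i + real j + real k - 1) / (real i + real j + real k - 2))"
proof -
  define n where "n = N + 1"
  define M where "M = 2 * m - 1"
  \<comment> \<open>The vertical edge of column \<open>2 * l\<close> that is centred on the axis; it
    is the short diagonal of the prescribed rhombus.\<close>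
  define c where "c = int (m - 1 + l)"
  have n: "n \<ge> 1" "1 \<le> l" "l \<le> n" "2 * l < 2 * n" using assms by (auto simp: n_def)
  have site: "(2 * l, c) \<in> sites n M"
    using assms by (auto simp: sites_def n_def M_def c_def of_nat_diff)
  have "card {T. rhombus_tiling n M T \<and> axis_rhombus l \<in> T}
      = card (path_families M (\<lambda>s x. \<not> (s = 2 * l \<and> x = c)) (2 * n) (\<lambda>j. int n + int j))"
    unfolding M_def card_tilings_with_axis_rhombus[OF n(1) assms(1)]
    by (fold M_def c_def, rule card_matchings_with_hole[OF site]) (use n in auto)
  then have "real (card {T. rhombus_tiling n M T \<and> axis_rhombus l \<in> T})
      = det (mat M M (\<lambda>(i, j). ibin (2 * n) (int n + int j - int i)
        - ibin (2 * l) (c - int i) * ibin (2 * (n - l)) (int n + int j - c)))"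
    using card_path_families_avoiding[OF n(2,3)] by simp
  also have "\<dots> = det (path_mat n M) * (1 - (\<Sum>k<m. kernel_term n l k))"
    unfolding M_def c_def by (rule det_path_mat_avoiding[OF n(1) assms(1) n(3)])
  also have "\<dots> = (1 - (\<Sum>k<m. kernel_term (N + 1) l k)) *
      (\<Prod>i = 1..n. \<Prod>j = 1..n. \<Prod>k = 1..M. (real i + real j + real k - 1) / (real i + real j + real k - 2))"
    unfolding det_path_mat macmahon_product n_def by (rule mult.commute)
  finally show ?thesis
    unfolding n_def M_def hole_sum_formula[OF assms] .
qed

end
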